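(* Let $(X,d)$ be a complete metric space. Then the following are equivalent: (1) $X$ admits a conical bicombing; (2) $X$ is a barycentric metric space, i.e. there exists a contracting barycenter map $\beta\colon P_1(X)\to X$.
   Context: A bicombing on $(X,d)$ is a map $\sigma\colon X\times X\times[0,1]\to X$ such that each $\sigma_{xy}:=\sigma(x,y,\cdot)$ is a geodesic from $x$ to $y$ ($\sigma_{xy}(0)=x$, $\sigma_{xy}(1)=y$, $d(\sigma_{xy}(s),\sigma_{xy}(t))=|s-t|d(x,y)$); it is conical if $d(\sigma_{xy}(t),\sigma_{x'y'}(t))\le(1-t)d(x,x')+t\,d(y,y')$ for all $x,y,x',y'\in X$, $t\in[0,1]$. $P_1(X)$ denotes the set of Radon probability measures $\mu$ on $X$ with $W_1(\mu,\delta_{x_0})<\infty$ for some (equivalently every) $x_0\in X$, equipped with the first Wasserstein distance $W_1(\mu,\nu)=\inf_{\gamma}\int_{X\times X}d(x,y)\,d\gamma(x,y)$, the infimum over all couplings $\gamma$ of $(\mu,\nu)$ (probability measures on $X\times X$ with marginals $\mu$ and $\nu$). A contracting barycenter map is a 1-Lipschitz map $\beta\colon (P_1(X),W_1)\to X$ with $\beta(\delta_x)=x$ for all $x\in X$. *)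

theory Defs
  imports "HOL-Probability.Probability"
begin

definition geodesic_from_to :: "('a::metric_space) \<Rightarrow> 'a \<Rightarrow> (real \<Rightarrow> 'a) \<Rightarrow> bool" where
  "geodesic_from_to x y g \<longleftrightarrow> g 0 = x \<and> g 1 = y \<and>
     (\<forall>s\<in>{0..1}. \<forall>t\<in>{0..1}. dist (g s) (g t) = \<bar>s - t\<bar> * dist x y)"

definition bicombing :: "('a::metric_space \<Rightarrow> 'a \<Rightarrow> real \<Rightarrow> 'a) \<Rightarrow> bool" where
  "bicombing \<sigma> \<longleftrightarrow> (\<forall>x y. geodesic_from_to x y (\<sigma> x y))"

definition conical_bicombing :: "('a::metric_space \<Rightarrow> 'a \<Rightarrow> real \<Rightarrow> 'a) \<Rightarrow> bool" where
  "conical_bicombing \<sigma> \<longleftrightarrow> bicombing \<sigma> \<and>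
     (\<forall>x y x' y'. \<forall>t\<in>{0..1}.
        dist (\<sigma> x y t) (\<sigma> x' y' t) \<le> (1 - t) * dist x x' + t * dist y y')"

definition radon_prob :: "('a::metric_space) measure \<Rightarrow> bool" where
  "radon_prob \<mu> \<longleftrightarrow> sets \<mu> = sets borel \<and> prob_space \<mu> \<and>
     (\<forall>B\<in>sets borel. emeasure \<mu> B = (SUP K\<in>{K. compact K \<and> K \<subseteq> B}. emeasure \<mu> K))"

definition P1 :: "('a::metric_space) measure set" where
  "P1 = {\<mu>. radon_prob \<mu> \<and> (\<exists>x0. (\<integral>\<^sup>+ x. ennreal (dist x x0) \<partial>\<mu>) < \<infinity>)}"

definition couplings :: "('a::metric_space) measure \<Rightarrow> 'a measure \<Rightarrow> ('a \<times> 'a) measure set" where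
  "couplings \<mu> \<nu> = {\<gamma>. sets \<gamma> = sets borel \<and> prob_space \<gamma> \<and>
      distr \<gamma> borel fst = \<mu> \<and> distr \<gamma> borel snd = \<nu>}"

definition W1 :: "('a::metric_space) measure \<Rightarrow> 'a measure \<Rightarrow> ennreal" where
  "W1 \<mu> \<nu> = (INF \<gamma>\<in>couplings \<mu> \<nu>. \<integral>\<^sup>+ z. ennreal (dist (fst z) (snd z)) \<partial>\<gamma>)"

definition contracting_barycenter_map :: "(('a::metric_space) measure \<Rightarrow> 'a) \<Rightarrow> bool" where
  "contracting_barycenter_map \<beta> \<longleftrightarrow>
     (\<forall>\<mu>\<in>P1. \<forall>\<nu>\<in>P1. ennreal (dist (\<beta> \<mu>) (\<beta> \<nu>)) \<le> W1 \<mu> \<nu>) \<and>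
     (\<forall>x. \<beta> (return borel x) = x)"

end

(* A barycenter map gives the conical bicombing sending (x, y, t) to the barycenter of
   (1 - t) \<delta>_x + t \<delta>_y; all estimates come from explicit couplings.

   Conversely, given a conical bicombing with midpoints m, the map w(x, y) = m(m(y, x), y) satisfies
   d(w(x, y), w(y, x)) \<le> d(x, y) / 2, so iterating (x, y) \<mapsto> (w(x, y), w(y, x)) collapses the pair to
   a point depending symmetrically on x and y. From a symmetric n-point mean B one obtains an
   (n + 1)-point mean by iterating A \<mapsto> {B(A - a) | a \<in> A}, which contracts the sum of all
   pairwise distances (Es-Sahib and Heinich, Navas). These means B_n need not be compatible with repetition of points,
   but for i.i.d. samples X, X' of size n the law of large numbers and the symmetry of B_n give
   E d(B_n(X), B_n(X')) \<rightarrow> 0, while E d(q, B_n(X)) decreases in n for every q. Hence B_n(X) converges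
   in mean to a point, the barycenter of the common law. It is 1-Lipschitz because one may sample
   from a coupling. Finally, measures in P_1 are approximated by images under simple functions. *)
theory Submission
  imports Defs
begin

section \<open>Symmetric means of finite multisets\<close>

definition cost :: "('a::metric_space \<times> 'a) multiset \<Rightarrow> real" where
  "cost Z = (\<Sum>z\<in>#Z. dist (fst z) (snd z))"

definition sum_dist :: "'a::metric_space \<Rightarrow> 'a multiset \<Rightarrow> real" where
  "sum_dist q A = (\<Sum>a\<in>#A. dist q a)"

definition spread :: "'a::metric_space multiset \<Rightarrow> real" where
  "spread A = (\<Sum>a\<in>#A. sum_dist a A)"

text \<open>Multisets encode unordered tuples, so means of multisets are symmetric by construction. A
  multiset of pairs is a matching between the multisets of its first and of its second components.\<close>

definition contracting_mean :: "nat \<Rightarrow> ('a::metric_space multiset \<Rightarrow> 'a) \<Rightarrow> bool" where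
  "contracting_mean n B \<longleftrightarrow>
     (\<forall>q. B (replicate_mset n q) = q) \<and>
     (\<forall>Z. size Z = n \<longrightarrow>
        real n * dist (B (image_mset fst Z)) (B (image_mset snd Z)) \<le> cost Z)"

section \<open>Distance sums and matching costs of multisets\<close>

lemma sum_mset_real_nonneg:
  fixes f :: "'a \<Rightarrow> real"
  assumes "\<And>x. 0 \<le> f x"
  shows "0 \<le> (\<Sum>x\<in>#A. f x)"
  by (induction A) (auto simp: assms)

lemma sum_dist_nonneg [simp]: "0 \<le> sum_dist q A"
  by (auto simp: sum_dist_def intro!: sum_mset_real_nonneg)

lemma member_le_sum_mset:
  fixes f :: "'a \<Rightarrow> real"
  assumes "a \<in># A" "\<And>x. 0 \<le> f x"
  shows "f a \<le> (\<Sum>x\<in>#A. f x)"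
proof -
  obtain A' where "A = add_mset a A'"
    using assms(1) by (metis insert_DiffM)
  moreover have "0 \<le> (\<Sum>x\<in>#A'. f x)"
    using assms(2) by (auto intro!: sum_mset_real_nonneg)
  ultimately show ?thesis by simp
qed

lemma dist_le_sum_dist: "a \<in># A \<Longrightarrow> dist q a \<le> sum_dist q A"
  unfolding sum_dist_def by (rule member_le_sum_mset) auto

lemma sum_dist_le_spread: "a \<in># A \<Longrightarrow> sum_dist a A \<le> spread A"
  unfolding spread_def by (rule member_le_sum_mset) auto

lemma sum_dist_triangle: "sum_dist p A \<le> real (size A) * dist p q + sum_dist q A"
proof (induction A)
  case (add a A)
  with dist_triangle[of p a q] show ?case by (simp add: sum_dist_def algebra_simps)
qed (simp add: sum_dist_def)

text \<open>The triangle inequality along \<open>p\<close>, \<open>fst z\<close>,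
  \<open>snd z\<close>, \<open>q\<close>, summed over the pairs \<open>z\<close>. When both sides of
  the matching have collapsed to points, it bounds the distance of these points by the cost.\<close>

lemma cost_triangle:
  "real (size Z) * dist p q
     \<le> sum_dist p (image_mset fst Z) + cost Z + sum_dist q (image_mset snd Z)"
proof (induction Z)
  case (add z Z)
  have "dist p q \<le> dist p (fst z) + dist (fst z) (snd z) + dist q (snd z)"
    by (metis add.commute add_left_mono dist_commute dist_triangle dist_triangle_le order.trans)
  with add show ?case by (simp add: sum_dist_def cost_def algebra_simps)
qed (auto simp: sum_dist_def cost_def)

lemma cost_const_left: "cost (image_mset (\<lambda>a. (q, a)) A) = sum_dist q A"
  by (simp add: cost_def sum_dist_def image_mset.compositionality comp_def)

text \<open>Against a constant multiset there is only one matching, so its cost depends on the other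
  side alone.\<close>

lemma cost_if_fst_const:
  assumes "image_mset fst Z = replicate_mset n q"
  shows "cost Z = sum_dist q (image_mset snd Z)"
proof -
  have "fst z = q" if "z \<in># Z" for z
    using that assms by (metis in_replicate_mset image_eqI set_image_mset)
  then show ?thesis
    by (simp add: cost_def sum_dist_def image_mset.compositionality comp_def cong: image_mset_cong)
qed

text \<open>Compare \<open>A\<close> with n copies of \<open>q\<close>, whose mean is
  \<open>q\<close>.\<close>

lemma contracting_mean_sum_dist:
  assumes "contracting_mean n B" "size A = n"
  shows "real n * dist q (B A) \<le> sum_dist q A"
proof -
  let ?Z = "image_mset (\<lambda>a. (q, a)) A"
  have "real n * dist (B (image_mset fst ?Z)) (B (image_mset snd ?Z)) \<le> cost ?Z"
    using assms by (simp add: contracting_mean_def del: image_mset.compositionality)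
  then show ?thesis
    using assms by (simp add: cost_const_left contracting_mean_def image_mset.compositionality
        comp_def image_mset_const_eq)
qed

section \<open>Means as limits of contracting iterations\<close>

text \<open>The iterates collapse because \<open>spread\<close> is halved, and they do not drift
  because \<Phi> never increases the cost of a matching; their limit point is \<open>B A\<close>.
  Since \<open>A\<close> and \<open>\<Phi> A\<close> have the same limit, \<open>B A\<close> obeys
  the distance bound of \<open>\<Phi> A\<close>. This bound later compares means of n and of n + 1
  points.\<close>

lemma iterated_mean:
  fixes \<Phi> :: "'a::complete_space multiset \<Rightarrow> 'a multiset"
  assumes "n > 0"
    and size: "\<And>A. size A = n \<Longrightarrow> size (\<Phi> A) = n"
    and shrink: "\<And>A. size A = n \<Longrightarrow> spread (\<Phi> A) \<le> spread A / 2"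
    and step: "\<And>Z. size Z = n \<Longrightarrow> \<exists>Z'. image_mset fst Z' = \<Phi> (image_mset fst Z) \<and>
      image_mset snd Z' = \<Phi> (image_mset snd Z) \<and> cost Z' \<le> cost Z"
    and const: "\<And>q. \<Phi> (replicate_mset n q) = replicate_mset n q"
  obtains B where "contracting_mean n B"
    and "\<And>q A. size A = n \<Longrightarrow> real n * dist q (B A) \<le> sum_dist q (\<Phi> A)"
proof -
  \<comment> \<open>Convergence of all entries at once, expressed without ordering the
    multisets.\<close>
  define limit where "limit A l \<longleftrightarrow> (\<lambda>k. sum_dist l ((\<Phi> ^^ k) A)) \<longlonglongrightarrow> 0" for A l
  have size_k: "size ((\<Phi> ^^ k) A) = n" if "size A = n" for k A
    using that by (induction k) (auto simp: size)
  have step_k: "\<exists>Z'. image_mset fst Z' = (\<Phi> ^^ k) (image_mset fst Z) \<and>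
      image_mset snd Z' = (\<Phi> ^^ k) (image_mset snd Z) \<and> cost Z' \<le> cost Z"
    if "size Z = n" for k Z
  proof (induction k)
    case (Suc k)
    then obtain Z' where Z': "image_mset fst Z' = (\<Phi> ^^ k) (image_mset fst Z)"
      "image_mset snd Z' = (\<Phi> ^^ k) (image_mset snd Z)" "cost Z' \<le> cost Z" by blast
    have "size Z' = n"
      using Z'(1) size_k[of "image_mset fst Z" k] that by (metis size_image_mset)
    from step[OF this] Z' show ?case by (auto intro: order_trans)
  qed auto
  have shrink_k: "spread ((\<Phi> ^^ k) A) \<le> spread A / 2 ^ k" if "size A = n" for k A
  proof (induction k)
    case (Suc k)
    have "spread ((\<Phi> ^^ Suc k) A) \<le> spread ((\<Phi> ^^ k) A) / 2"
      using shrink[OF size_k[OF that, of k]] by simp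
    also have "\<dots> \<le> spread A / 2 ^ k / 2" using Suc by (rule divide_right_mono) simp
    finally show ?case by (simp add: mult.commute)
  qed auto
  have const_k: "(\<Phi> ^^ k) (replicate_mset n q) = replicate_mset n q" for k q
    by (induction k) (auto simp: const)
  \<comment> \<open>\<Phi> fixes the constant multiset at \<open>q\<close>, so the matching provided
    by \<open>step_k\<close> still has a constant side and its cost is again a distance sum.\<close>
  have mono_k: "sum_dist q ((\<Phi> ^^ k) A) \<le> sum_dist q A" if "size A = n" for k A q
  proof -
    let ?Z = "image_mset (\<lambda>a. (q, a)) A"
    have f: "image_mset fst ?Z = replicate_mset n q" and s: "image_mset snd ?Z = A"
      using that by (simp_all add: image_mset.compositionality comp_def image_mset_const_eq)
    have "size ?Z = n" using that by simp
    from step_k[OF this, of k] obtain Z' where Z': "image_mset fst Z' = replicate_mset n q"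
      "image_mset snd Z' = (\<Phi> ^^ k) A" "cost Z' \<le> cost ?Z"
      unfolding f s const_k by blast
    then show ?thesis by (metis cost_const_left cost_if_fst_const)
  qed
  have ex_limit: "\<exists>l. limit A l" if A: "size A = n" for A
  proof -
    define b where "b k = (SOME x. x \<in># (\<Phi> ^^ k) A)" for k
    have b: "b k \<in># (\<Phi> ^^ k) A" for k
    proof -
      have "(\<Phi> ^^ k) A \<noteq> {#}" using size_k[OF A, of k] \<open>n > 0\<close> by force
      then show ?thesis unfolding b_def by (meson multiset_nonemptyE someI_ex)
    qed
    have b_sum: "sum_dist (b k) ((\<Phi> ^^ k) A) \<le> spread A / 2 ^ k" for k
      using sum_dist_le_spread[OF b] shrink_k[OF A, of k] by (rule order_trans)
    \<comment> \<open>By \<open>mono_k\<close> the distance sum from \<open>b k\<close> does not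
      grow after the k-th iterate, where it is already geometrically small.\<close>
    have b_dist: "dist (b k) (b (k + j)) \<le> spread A / 2 ^ k" for k j
    proof -
      have "dist (b k) (b (k + j)) \<le> sum_dist (b k) ((\<Phi> ^^ (j + k)) A)"
        using dist_le_sum_dist[OF b[of "k + j"]] by (simp add: add.commute)
      also have "\<dots> \<le> sum_dist (b k) ((\<Phi> ^^ k) A)"
        using mono_k[OF size_k[OF A, of k], of "b k" j] by (simp add: funpow_add)
      finally show ?thesis using b_sum[of k] by simp
    qed
    have lim0: "(\<lambda>k. c / 2 ^ k) \<longlonglongrightarrow> (0::real)" for c
      using tendsto_mult[OF tendsto_const[of c] LIMSEQ_inverse_realpow_zero[of 2]]
      by (simp add: divide_inverse)
    have "Cauchy b"
    proof (rule metric_CauchyI)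
      fix e :: real assume "0 < e"
      with lim0[of "spread A"] have "\<forall>\<^sub>F k in sequentially. spread A / 2 ^ k < e / 2"
        by (intro order_tendstoD(2)[where a = "e/2"]) auto
      then obtain k where k: "spread A / 2 ^ k < e / 2" by (auto simp: eventually_sequentially)
      have "dist (b i) (b j) < e" if "i \<ge> k" "j \<ge> k" for i j
      proof -
        have "dist (b k) (b i) < e / 2" "dist (b k) (b j) < e / 2"
          using order.strict_trans1[OF b_dist[of k "i - k"] k]
            order.strict_trans1[OF b_dist[of k "j - k"] k] that by auto
        then show ?thesis by (metis dist_commute dist_triangle_half_l)
      qed
      then show "\<exists>M. \<forall>i\<ge>M. \<forall>j\<ge>M. dist (b i) (b j) < e" by blast
    qed
    then obtain l where l: "b \<longlonglongrightarrow> l" using Cauchy_convergent convergent_def by blast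
    have "(\<lambda>k. sum_dist l ((\<Phi> ^^ k) A)) \<longlonglongrightarrow> 0"
    proof (rule tendsto_sandwich[OF _ _ tendsto_const])
      have "sum_dist l ((\<Phi> ^^ k) A) \<le> n * dist (b k) l + spread A / 2 ^ k" for k
        using sum_dist_triangle[of l "(\<Phi> ^^ k) A" "b k"] b_sum[of k]
        by (simp add: size_k[OF A] dist_commute)
      then show "\<forall>\<^sub>F k in sequentially. sum_dist l ((\<Phi> ^^ k) A) \<le> n * dist (b k) l + spread A / 2 ^ k"
        by simp
      have "(\<lambda>k. n * dist (b k) l + spread A / 2 ^ k) \<longlonglongrightarrow> n * dist l l + 0"
        by (intro tendsto_intros l lim0)
      then show "(\<lambda>k. n * dist (b k) l + spread A / 2 ^ k) \<longlonglongrightarrow> 0" by simp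
    qed simp
    then show ?thesis unfolding limit_def by blast
  qed
  \<comment> \<open>The matching carried along by the iteration never costs more than
    \<open>Z\<close>, while the two outer terms of \<open>cost_triangle\<close> vanish in the
    limit.\<close>
  have limit_dist: "n * dist l l' \<le> cost Z"
    if "size Z = n" "limit (image_mset fst Z) l" "limit (image_mset snd Z) l'" for Z l l'
  proof (rule LIMSEQ_le_const)
    let ?A = "\<lambda>k. sum_dist l ((\<Phi> ^^ k) (image_mset fst Z))"
    let ?B = "\<lambda>k. sum_dist l' ((\<Phi> ^^ k) (image_mset snd Z))"
    have "(\<lambda>k. ?A k + cost Z + ?B k) \<longlonglongrightarrow> 0 + cost Z + 0"
      using that unfolding limit_def by (intro tendsto_intros)
    then show "(\<lambda>k. ?A k + cost Z + ?B k) \<longlonglongrightarrow> cost Z" by simp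
    have "n * dist l l' \<le> ?A k + cost Z + ?B k" for k
    proof -
      obtain Z' where Z': "image_mset fst Z' = (\<Phi> ^^ k) (image_mset fst Z)"
        "image_mset snd Z' = (\<Phi> ^^ k) (image_mset snd Z)" "cost Z' \<le> cost Z"
        using step_k \<open>size Z = n\<close> by blast
      have "size Z' = n"
        using Z'(1) size_k[of "image_mset fst Z" k] that by (metis size_image_mset)
      with cost_triangle[of Z' l l'] Z' show ?thesis by simp
    qed
    then show "\<exists>N. \<forall>k\<ge>N. n * dist l l' \<le> ?A k + cost Z + ?B k" by blast
  qed
  \<comment> \<open>The diagonal matching of \<open>A\<close> with itself costs nothing.\<close>
  have unique: "l = l'" if "size A = n" "limit A l" "limit A l'" for A l l'
  proof -
    have "n * dist l l' \<le> cost (image_mset (\<lambda>a. (a, a)) A)"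
      using that by (intro limit_dist) (simp_all add: image_mset.compositionality comp_def)
    also have "\<dots> = 0" by (simp add: cost_def image_mset.compositionality comp_def)
    finally show ?thesis using \<open>n > 0\<close> by (simp add: mult_le_0_iff)
  qed
  define B where "B A = (SOME l. limit A l)" for A
  have B: "limit A (B A)" if "size A = n" for A
    unfolding B_def using ex_limit[OF that] by (rule someI_ex)
  have "limit (replicate_mset n q) q" for q
    by (simp add: limit_def const_k sum_dist_def)
  then have "contracting_mean n B"
    unfolding contracting_mean_def
    using unique[OF size_replicate_mset B[OF size_replicate_mset]] limit_dist[OF _ B B] by simp
  moreover have "real n * dist q (B A) \<le> sum_dist q (\<Phi> A)" if A: "size A = n" for q A
  proof -
    \<comment> \<open>The iterates of \<open>\<Phi> A\<close> are those of \<open>A\<close> with the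
      first one dropped.\<close>
    have "limit (\<Phi> A) (B A)"
      using LIMSEQ_Suc[OF B[OF A, unfolded limit_def]]
      by (simp add: limit_def funpow_Suc_right del: funpow.simps)
    then have "B (\<Phi> A) = B A" using unique size A B by blast
    then show ?thesis using contracting_mean_sum_dist[OF \<open>contracting_mean n B\<close> size[OF A]] by metis
  qed
  ultimately show ?thesis using that by blast
qed

section \<open>Means of n points from a conical bicombing\<close>

lemma conical_bicombing_dist:
  assumes "conical_bicombing \<sigma>" "t \<in> {0..1}"
  shows "dist (\<sigma> x y t) (\<sigma> x' y' t) \<le> (1 - t) * dist x x' + t * dist y y'"
  using assms by (auto simp: conical_bicombing_def)

lemma conical_bicombing_mid:
  assumes "conical_bicombing \<sigma>"
  shows "dist (\<sigma> x y (1/2)) x = dist x y / 2" "dist (\<sigma> x y (1/2)) y = dist x y / 2"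
proof -
  have g: "\<sigma> x y 0 = x" "\<sigma> x y 1 = y"
    and d: "\<forall>s\<in>{0..1}. \<forall>t\<in>{0..1}. dist (\<sigma> x y s) (\<sigma> x y t) = \<bar>s - t\<bar> * dist x y"
    using assms by (auto simp: conical_bicombing_def bicombing_def geodesic_from_to_def)
  show "dist (\<sigma> x y (1/2)) x = dist x y / 2" "dist (\<sigma> x y (1/2)) y = dist x y / 2"
    using d[rule_format, of "1/2" 0] d[rule_format, of "1/2" 1] g by simp_all
qed

text \<open>The midpoint map need not be symmetric, and conicality bounds
  \<open>dist (m x y) (m y x)\<close> only by \<open>dist x y\<close>, so replacing a pair by its
  two midpoints need not shrink it. The map \<open>w\<close> leans towards its second argument. Its
  Lipschitz weights 1/4 and 3/4 add up to 1, so passing to \<open>w x y\<close> and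
  \<open>w y x\<close> does not increase matching costs.\<close>

lemma contracting_mean_2:
  fixes \<sigma> :: "'a::complete_space \<Rightarrow> 'a \<Rightarrow> real \<Rightarrow> 'a"
  assumes \<sigma>: "conical_bicombing \<sigma>"
  obtains B :: "'a multiset \<Rightarrow> 'a" where "contracting_mean 2 B"
proof -
  define m where "m x y = \<sigma> x y (1/2)" for x y
  define w where "w x y = m (m y x) y" for x y
  have m_dist: "dist (m x y) (m x' y') \<le> (dist x x' + dist y y') / 2" for x y x' y'
    using conical_bicombing_dist[OF \<sigma>, of "1/2"] by (simp add: m_def field_simps)
  have m_left: "dist (m x y) x = dist x y / 2" and m_right: "dist (m x y) y = dist x y / 2" for x y
    using conical_bicombing_mid[OF \<sigma>] by (simp_all add: m_def)
  have w_dist: "dist (w x y) (w x' y') \<le> dist x x' / 4 + 3 * dist y y' / 4" for x y x' y'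
    using m_dist[of "m y x" y "m y' x'" y'] m_dist[of y x y' x'] by (simp add: w_def)
  have w_swap: "dist (w x y) (w y x) \<le> dist x y / 2" for x y
  proof -
    \<comment> \<open>The route goes through \<open>m y x\<close>: \<open>w x y\<close> is the
      midpoint of \<open>m y x\<close> and \<open>y\<close>, while \<open>w y x\<close> is
      \<open>m (m x y) x\<close>, which shares its second argument with
      \<open>m y x\<close>.\<close>
    have "dist (w x y) (m y x) = dist x y / 4"
      using m_left[of "m y x" y] m_left[of y x] by (simp add: w_def dist_commute)
    moreover have "dist (m y x) (w y x) \<le> dist x y / 4"
      using m_dist[of y x "m x y" x] m_right[of x y] by (simp add: w_def dist_commute)
    ultimately show ?thesis using dist_triangle[of "w x y" "w y x" "m y x"] by simp
  qed
  have w_same: "w x x = x" for x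
    using m_left[of x x] by (simp add: w_def)
  \<comment> \<open>Both orders of the two entries give the same multiset, so the choice is
    determined.\<close>
  define \<Phi> where "\<Phi> A = (SOME A'. \<exists>x y. A = {#x, y#} \<and> A' = {#w x y, w y x#})" for A
  have \<Phi>: "\<Phi> {#x, y#} = {#w x y, w y x#}" for x y
    unfolding \<Phi>_def by (rule some_equality) (auto simp: add_eq_conv_ex)
  have two: "\<exists>x y. A = {#x, y#}" if sA: "size A = 2" for A :: "'b multiset"
  proof -
    obtain x A' where "A = add_mset x A'"
      using sA size_eq_Suc_imp_eq_union[of A 1] by (auto simp: numeral_2_eq_2)
    moreover then obtain y where "A' = {#y#}"
      using sA size_1_singleton_mset[of A'] by auto
    ultimately show ?thesis by blast
  qed
  obtain B :: "'a multiset \<Rightarrow> 'a" where "contracting_mean 2 B"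
  proof (rule iterated_mean[of 2 \<Phi>])
    show "size (\<Phi> A) = 2" if A: "size A = 2" for A
    proof -
      obtain x y where "A = {#x, y#}" using two[OF A] by blast
      then show ?thesis by (simp add: \<Phi>)
    qed
    show "spread (\<Phi> A) \<le> spread A / 2" if A: "size A = 2" for A
    proof -
      obtain x y where "A = {#x, y#}" using two[OF A] by blast
      then show ?thesis using w_swap[of x y]
        by (simp add: \<Phi> spread_def sum_dist_def dist_commute)
    qed
    show "\<exists>Z'. image_mset fst Z' = \<Phi> (image_mset fst Z) \<and>
      image_mset snd Z' = \<Phi> (image_mset snd Z) \<and> cost Z' \<le> cost Z" if Z: "size Z = 2" for Z
    proof -
      obtain x x' y y' where Z: "Z = {#(x, x'), (y, y')#}" using two[OF Z] by (metis surj_pair)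
      show ?thesis
        by (rule exI[of _ "{#(w x y, w x' y'), (w y x, w y' x')#}"])
          (use w_dist[of x y x' y'] w_dist[of y x y' x'] in \<open>simp add: Z \<Phi> cost_def\<close>)
    qed
    show "\<Phi> (replicate_mset 2 q) = replicate_mset 2 q" for q
      by (simp add: numeral_2_eq_2 \<Phi> w_same)
    fix B :: "'a multiset \<Rightarrow> 'a" assume "contracting_mean 2 B"
    then show ?thesis by (rule that)
  qed simp
  then show ?thesis using that by blast
qed

text \<open>Each entry is replaced by the mean of the others. Two such subfamilies differ in one
  entry, so their means are at most \<open>dist a b / n\<close> apart; hence the spread drops to at
  most 1/n of its value, and 1/n is at most 1/2 because n is at least 2. The second conclusion is
  the extra bound of \<open>iterated_mean\<close> for this map.\<close>

lemma contracting_mean_Suc: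
  fixes B :: "'a::complete_space multiset \<Rightarrow> 'a"
  assumes B: "contracting_mean n B" and "n \<ge> 2"
  obtains B' where "contracting_mean (Suc n) B'"
    and "\<And>q A. size A = Suc n \<Longrightarrow>
      real (Suc n) * dist q (B' A) \<le> (\<Sum>a\<in>#A. dist q (B (A - {#a#})))"
proof -
  define \<Phi> where "\<Phi> A = image_mset (\<lambda>a. B (A - {#a#})) A" for A
  have B_dist: "n * dist (B (image_mset fst Z)) (B (image_mset snd Z)) \<le> cost Z"
    if "size Z = n" for Z
    using B that by (simp add: contracting_mean_def)
  have remove_dist: "n * dist (B (A - {#a#})) (B (A - {#b#})) \<le> dist a b"
    if A: "size A = Suc n" "a \<in># A" "b \<in># A" for A a b
  proof (cases "a = b")
    case False
    then obtain C where C: "A = add_mset a (add_mset b C)"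
      using A by (metis insert_DiffM insert_noteq_member)
    \<comment> \<open>Omitting \<open>a\<close> leaves \<open>b\<close> and \<open>C\<close>,
      omitting \<open>b\<close> leaves \<open>a\<close> and \<open>C\<close>: match \<open>b\<close>
      with \<open>a\<close>, and \<open>C\<close> with itself.\<close>
    have "n * dist (B (image_mset fst (add_mset (b, a) (image_mset (\<lambda>c. (c, c)) C))))
        (B (image_mset snd (add_mset (b, a) (image_mset (\<lambda>c. (c, c)) C))))
        \<le> cost (add_mset (b, a) (image_mset (\<lambda>c. (c, c)) C))"
      using A(1) C by (intro B_dist) simp
    then show ?thesis
      by (simp add: C cost_def image_mset.compositionality comp_def dist_commute add_mset_commute)
  qed simp
  obtain B' where "contracting_mean (Suc n) B'"
    "\<And>q A. size A = Suc n \<Longrightarrow> real (Suc n) * dist q (B' A) \<le> sum_dist q (\<Phi> A)"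
  proof (rule iterated_mean[of "Suc n" \<Phi>])
    show "size (\<Phi> A) = Suc n" if "size A = Suc n" for A
      using that by (simp add: \<Phi>_def)
    show "spread (\<Phi> A) \<le> spread A / 2" if A: "size A = Suc n" for A
    proof -
      have "n * spread (\<Phi> A) = (\<Sum>a\<in>#A. \<Sum>b\<in>#A. n * dist (B (A - {#a#})) (B (A - {#b#})))"
        by (simp add: \<Phi>_def spread_def sum_dist_def sum_mset_distrib_left
            image_mset.compositionality comp_def)
      also have "\<dots> \<le> spread A"
        unfolding spread_def sum_dist_def using remove_dist[OF A] by (intro sum_mset_mono)
      finally have *: "n * spread (\<Phi> A) \<le> spread A" .
      have "2 * spread (\<Phi> A) \<le> n * spread (\<Phi> A)"
        using \<open>n \<ge> 2\<close> by (intro mult_right_mono) (auto simp: spread_def intro!: sum_mset_real_nonneg)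
      with * show ?thesis by simp
    qed
    show "\<exists>Z'. image_mset fst Z' = \<Phi> (image_mset fst Z) \<and>
      image_mset snd Z' = \<Phi> (image_mset snd Z) \<and> cost Z' \<le> cost Z" if Z: "size Z = Suc n" for Z
    proof (intro exI conjI)
      let ?Z = "image_mset (\<lambda>z. (B (image_mset fst (Z - {#z#})), B (image_mset snd (Z - {#z#})))) Z"
      show "image_mset fst ?Z = \<Phi> (image_mset fst Z)" "image_mset snd ?Z = \<Phi> (image_mset snd Z)"
        by (auto simp: \<Phi>_def image_mset.compositionality comp_def image_mset_Diff intro!: image_mset_cong)
      \<comment> \<open>Among the n + 1 reduced matchings each pair of \<open>Z\<close> is missing
        exactly once, so their costs add up to \<open>n * cost Z\<close>.\<close>
      have "n * cost ?Z = (\<Sum>z\<in>#Z. n * dist (B (image_mset fst (Z - {#z#}))) (B (image_mset snd (Z - {#z#}))))"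
        by (simp add: cost_def sum_mset_distrib_left image_mset.compositionality comp_def)
      also have "\<dots> \<le> (\<Sum>z\<in>#Z. cost (Z - {#z#}))"
        using Z by (intro sum_mset_mono B_dist) (simp add: size_Diff_singleton)
      also have "\<dots> = (\<Sum>z\<in>#Z. cost Z - dist (fst z) (snd z))"
      proof (rule arg_cong[of _ _ sum_mset], rule image_mset_cong)
        fix z assume "z \<in># Z"
        then have "cost Z = cost (add_mset z (Z - {#z#}))" by simp
        then show "cost (Z - {#z#}) = cost Z - dist (fst z) (snd z)" by (simp add: cost_def)
      qed
      also have "\<dots> = size Z * cost Z - cost Z"
      proof -
        have "(\<Sum>z\<in>#Z'. c - f z) = size Z' * c - (\<Sum>z\<in>#Z'. f z)" for Z' :: "('a \<times> 'a) multiset" and c :: real and f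
          by (induction Z') (auto simp: algebra_simps)
        then show ?thesis by (simp add: cost_def)
      qed
      also have "\<dots> = n * cost Z" using Z by (simp add: algebra_simps)
      finally show "cost ?Z \<le> cost Z" using \<open>n \<ge> 2\<close> by simp
    qed
    show "\<Phi> (replicate_mset (Suc n) q) = replicate_mset (Suc n) q" for q
    proof -
      have "B (replicate_mset n q) = q"
        using B by (simp add: contracting_mean_def)
      then have "\<Phi> (replicate_mset (Suc n) q) = image_mset (\<lambda>a. q) (replicate_mset (Suc n) q)"
        unfolding \<Phi>_def by (intro image_mset_cong) (auto split: if_splits)
      then show ?thesis by simp
    qed
    fix B' assume "contracting_mean (Suc n) B'"
      "\<And>q A. size A = Suc n \<Longrightarrow> real (Suc n) * dist q (B' A) \<le> sum_dist q (\<Phi> A)"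
    then show ?thesis by (rule that)
  qed simp
  then show ?thesis using that
    by (simp add: \<Phi>_def sum_dist_def image_mset.compositionality comp_def)
qed

text \<open>Each mean is built from its predecessor, so that the averaging inequality links
  consecutive sizes. The recursion starts from pairs, hence the index shift by 2.\<close>

lemma contracting_means:
  fixes \<sigma> :: "'a::complete_space \<Rightarrow> 'a \<Rightarrow> real \<Rightarrow> 'a"
  assumes "conical_bicombing \<sigma>"
  obtains B :: "nat \<Rightarrow> 'a multiset \<Rightarrow> 'a"
  where "\<And>n. n \<ge> 2 \<Longrightarrow> contracting_mean n (B n)"
    and "\<And>n q A. n \<ge> 2 \<Longrightarrow> size A = Suc n \<Longrightarrow>
      real (Suc n) * dist q (B (Suc n) A) \<le> (\<Sum>a\<in>#A. dist q (B n (A - {#a#})))"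
proof -
  define Q where "Q n B B' \<longleftrightarrow> (\<forall>q A. size A = Suc n \<longrightarrow>
      real (Suc n) * dist q (B' A) \<le> (\<Sum>a\<in>#A. dist q (B (A - {#a#}))))"
    for n and B B' :: "'a multiset \<Rightarrow> 'a"
  obtain B\<^sub>2 :: "'a multiset \<Rightarrow> 'a" where B\<^sub>2: "contracting_mean 2 B\<^sub>2"
    by (rule contracting_mean_2[OF assms])
  have "\<exists>f. \<forall>n. contracting_mean (n + 2) (f n) \<and> Q (n + 2) (f n) (f (Suc n))"
  proof (rule dependent_nat_choice)
    show "\<exists>B :: 'a multiset \<Rightarrow> 'a. contracting_mean (0 + 2) B"
      using B\<^sub>2 by (auto simp only: add_0)
    fix B :: "'a multiset \<Rightarrow> 'a" and n assume "contracting_mean (n + 2) B"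
    then show "\<exists>B'. contracting_mean (Suc n + 2) B' \<and> Q (n + 2) B B'"
      by (rule contracting_mean_Suc) (auto simp: Q_def)
  qed
  then obtain f where f: "\<And>n. contracting_mean (n + 2) (f n)" "\<And>n. Q (n + 2) (f n) (f (Suc n))"
    by blast
  show ?thesis
  proof (rule that[of "\<lambda>n. f (n - 2)"])
    fix n :: nat assume n: "n \<ge> 2"
    show "contracting_mean n (f (n - 2))" using f(1)[of "n - 2"] n by (simp only: le_add_diff_inverse2)
    show "real (Suc n) * dist q (f (Suc n - 2) A) \<le> (\<Sum>a\<in>#A. dist q (f (n - 2) (A - {#a#})))"
      if "size A = Suc n" for q A
      using f(2)[of "n - 2"] that Suc_diff_le[OF n]
      unfolding Q_def le_add_diff_inverse2[OF n] by simp
  qed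
qed

section \<open>Barycenters of finitely supported distributions\<close>

text \<open>The law of n independent draws with their order forgotten, which suits symmetric
  means.\<close>

primrec sample_pmf :: "nat \<Rightarrow> 'a pmf \<Rightarrow> 'a multiset pmf" where
  "sample_pmf 0 p = return_pmf {#}"
| "sample_pmf (Suc n) p = bind_pmf p (\<lambda>x. map_pmf (add_mset x) (sample_pmf n p))"

lemma finite_set_sample_pmf [simp]:
  "finite (set_pmf p) \<Longrightarrow> finite (set_pmf (sample_pmf n p))"
  by (induction n) auto

lemma size_sample_pmf: "A \<in> set_pmf (sample_pmf n p) \<Longrightarrow> size A = n"
  by (induction n arbitrary: A) auto

lemma set_mset_sample_pmf: "A \<in> set_pmf (sample_pmf n p) \<Longrightarrow> set_mset A \<subseteq> set_pmf p"
  by (induction n arbitrary: A) (simp, fastforce)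

text \<open>Used with \<open>fst\<close> and \<open>snd\<close>: a sample of pairs is a matching
  between samples of the two marginals.\<close>

lemma sample_map_pmf:
  "sample_pmf n (map_pmf f p) = map_pmf (image_mset f) (sample_pmf n p)"
proof (induction n)
  case (Suc n)
  then show ?case
    by (simp add: bind_map_pmf map_bind_pmf pmf.map_comp comp_def)
qed simp

lemma sample_return_pmf: "sample_pmf n (return_pmf x) = return_pmf (replicate_mset n x)"
  by (induction n) (auto simp: bind_return_pmf)

section \<open>Moments of i.i.d. samples\<close>

abbreviation expectation :: "'a pmf \<Rightarrow> ('a \<Rightarrow> real) \<Rightarrow> real" where
  "expectation p f \<equiv> measure_pmf.expectation p f"

lemma expectation_mono_finite:
  assumes "finite (set_pmf p)" "\<And>x. x \<in> set_pmf p \<Longrightarrow> f x \<le> g x"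
  shows "expectation p f \<le> expectation p g"
  using assms by (intro integral_mono_AE integrable_measure_pmf_finite) (auto simp: AE_measure_pmf_iff)

lemma expectation_add_finite:
  "finite (set_pmf p) \<Longrightarrow> expectation p (\<lambda>x. f x + g x) = expectation p f + expectation p g"
  by (simp add: integrable_measure_pmf_finite)

lemma expectation_bind_finite:
  assumes "finite (set_pmf p)" "\<And>x. x \<in> set_pmf p \<Longrightarrow> finite (set_pmf (f x))"
  shows "expectation (bind_pmf p f) h = expectation p (\<lambda>x. expectation (f x) h)"
  using assms by (simp add: pmf_expectation_bind[of "set_pmf p"] integral_measure_pmf[of "set_pmf p" p])

lemma expectation_sample_Suc:
  "finite (set_pmf p) \<Longrightarrow> expectation (sample_pmf (Suc n) p) h =
     expectation p (\<lambda>x. expectation (sample_pmf n p) (\<lambda>A. h (add_mset x A)))"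
  by (simp add: expectation_bind_finite)

text \<open>A sample of size n + 1 with one draw omitted is a sample of size n, whichever draw it
  is. The induction splits off one draw \<open>x\<close>: either \<open>x\<close> is omitted, or the
  omission happens in the rest, where the hypothesis applies to \<open>g\<close> with
  \<open>x\<close> added.\<close>

lemma expectation_sample_remove:
  assumes p: "finite (set_pmf p)"
  shows "expectation (sample_pmf (Suc n) p) (\<lambda>A. \<Sum>a\<in>#A. g (A - {#a#})) =
           real (Suc n) * expectation (sample_pmf n p) g"
proof (induction n arbitrary: g)
  case 0
  then show ?case using p by (simp add: expectation_sample_Suc del: sample_pmf.simps(2))
next
  case (Suc n)
  have remove: "(\<Sum>a\<in>#add_mset x A. g (add_mset x A - {#a#})) =
      g A + (\<Sum>a\<in>#A. g (add_mset x (A - {#a#})))" for x A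
    by (auto intro!: arg_cong[of _ _ sum_mset] image_mset_cong)
  have "expectation (sample_pmf (Suc (Suc n)) p) (\<lambda>A. \<Sum>a\<in>#A. g (A - {#a#})) =
      expectation p (\<lambda>x. expectation (sample_pmf (Suc n) p)
        (\<lambda>A. g A + (\<Sum>a\<in>#A. g (add_mset x (A - {#a#})))))"
    unfolding expectation_sample_Suc[OF p, of "Suc n"] remove ..
  also have "\<dots> = expectation p (\<lambda>x. expectation (sample_pmf (Suc n) p) g +
      real (Suc n) * expectation (sample_pmf n p) (\<lambda>A. g (add_mset x A)))"
    unfolding expectation_add_finite[OF finite_set_sample_pmf[OF p]]
      Suc.IH[of "\<lambda>A. g (add_mset _ A)"] ..
  also have "\<dots> = real (Suc (Suc n)) * expectation (sample_pmf (Suc n) p) g"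
    unfolding expectation_add_finite[OF p] expectation_sample_Suc[OF p, of n g]
    by (simp add: expectation_add_finite[OF p] algebra_simps)
  finally show ?case .
qed

lemma expectation_sample_sum:
  assumes p: "finite (set_pmf p)"
  shows "expectation (sample_pmf n p) (\<lambda>A. \<Sum>a\<in>#A. f a) = real n * expectation p f"
proof (induction n)
  case (Suc n)
  have "expectation (sample_pmf (Suc n) p) (\<lambda>A. \<Sum>a\<in>#A. f a) =
      expectation p (\<lambda>x. f x + real n * expectation p f)"
    unfolding expectation_sample_Suc[OF p]
    by (simp add: expectation_add_finite p Suc.IH)
  then show ?case by (simp add: expectation_add_finite p algebra_simps)
qed simp

text \<open>Independence and centring remove the mixed terms, so variances add.\<close>

lemma expectation_sample_sum_square:
  assumes p: "finite (set_pmf p)" and f: "expectation p f = 0"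
  shows "expectation (sample_pmf n p) (\<lambda>A. (\<Sum>a\<in>#A. f a)\<^sup>2) = real n * expectation p (\<lambda>x. (f x)\<^sup>2)"
proof (induction n)
  case (Suc n)
  have sq: "(\<Sum>a\<in>#add_mset x A. f a)\<^sup>2 = ((f x)\<^sup>2 + 2 * f x * (\<Sum>a\<in>#A. f a)) + (\<Sum>a\<in>#A. f a)\<^sup>2" for x A
    by (simp add: power2_eq_square algebra_simps)
  have "expectation (sample_pmf (Suc n) p) (\<lambda>A. (\<Sum>a\<in>#A. f a)\<^sup>2) =
      expectation p (\<lambda>x. (f x)\<^sup>2 + real n * expectation p (\<lambda>x. (f x)\<^sup>2))"
    unfolding expectation_sample_Suc[OF p] sq
    by (simp add: expectation_add_finite p Suc.IH expectation_sample_sum f)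
  then show ?case by (simp add: expectation_add_finite p algebra_simps)
qed simp

lemma expectation_sample_abs_sum:
  assumes p: "finite (set_pmf p)" and f: "expectation p f = 0" and bound: "\<And>x. \<bar>f x\<bar> \<le> 1"
  shows "expectation (sample_pmf n p) (\<lambda>A. \<bar>\<Sum>a\<in>#A. f a\<bar>) \<le> sqrt (real n)"
proof (cases "n = 0")
  case False
  let ?r = "sqrt (real n)"
  have r: "0 < ?r" "?r * ?r = n" using False by simp_all
  \<comment> \<open>The inequality of arithmetic and geometric means stands in for Cauchy-Schwarz.
    The weight is balanced: a second moment of at most n makes each term at most half of
    \<open>?r\<close>.\<close>
  have "\<bar>t\<bar> \<le> (1 / (2 * ?r)) * t\<^sup>2 + ?r / 2" for t :: real
  proof -
    have "0 \<le> (\<bar>t\<bar> - ?r)\<^sup>2" by simp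
    then have "2 * ?r * \<bar>t\<bar> \<le> t\<^sup>2 + ?r * ?r" by (simp add: power2_eq_square algebra_simps)
    then show ?thesis using r(1) by (simp add: field_simps)
  qed
  then have "expectation (sample_pmf n p) (\<lambda>A. \<bar>\<Sum>a\<in>#A. f a\<bar>) \<le>
      expectation (sample_pmf n p) (\<lambda>A. (1 / (2 * ?r)) * (\<Sum>a\<in>#A. f a)\<^sup>2 + ?r / 2)"
    using p by (intro expectation_mono_finite) auto
  also have "\<dots> = (1 / (2 * ?r)) * (n * expectation p (\<lambda>x. (f x)\<^sup>2)) + ?r / 2"
    unfolding expectation_add_finite[OF finite_set_sample_pmf[OF p]] integral_mult_right_zero
      expectation_sample_sum_square[OF p f] by simp
  also have "\<dots> \<le> (1 / (2 * ?r)) * (n * 1) + ?r / 2"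
  proof -
    have "expectation p (\<lambda>x. (f x)\<^sup>2) \<le> expectation p (\<lambda>x. 1)"
      using p bound by (intro expectation_mono_finite) (auto simp: abs_square_le_1)
    then show ?thesis using r(1) by (intro add_mono mult_left_mono) auto
  qed
  also have "\<dots> = ?r" using r by (simp add: field_simps)
  finally show ?thesis .
qed simp

text \<open>For a sample \<open>A\<close> of \<open>p\<close> this is the unnormalised l1 distance
  between its empirical distribution and \<open>p\<close>.\<close>

definition deviation :: "'a pmf \<Rightarrow> 'a multiset \<Rightarrow> real" where
  "deviation p A = (\<Sum>s\<in>set_pmf p. \<bar>real (count A s) - real (size A) * pmf p s\<bar>)"

text \<open>A quantitative law of large numbers: at each atom the centred count is a sum of centred
  indicators, so the deviation is of order sqrt n and thus small compared with n.\<close>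

lemma expectation_deviation:
  assumes p: "finite (set_pmf p)"
  shows "expectation (sample_pmf n p) (deviation p) \<le> card (set_pmf p) * sqrt (real n)"
proof -
  have "expectation (sample_pmf n p) (\<lambda>A. \<bar>real (count A s) - real (size A) * pmf p s\<bar>) \<le> sqrt n" for s
  proof -
    define f where "f x = indicator {s} x - pmf p s" for x
    have sum_f: "(\<Sum>a\<in>#A. f a) = real (count A s) - real (size A) * pmf p s" for A
      by (induction A) (auto simp: f_def indicator_def algebra_simps)
    have "expectation p f = 0"
      unfolding f_def by (subst Bochner_Integration.integral_diff)
        (auto simp: integrable_measure_pmf_finite p pmf.rep_eq)
    moreover have "\<bar>f x\<bar> \<le> 1" for x
      using pmf_le_1[of p s] pmf_nonneg[of p s] by (auto simp: f_def indicator_def)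
    ultimately show ?thesis using expectation_sample_abs_sum[OF p, of f n] by (simp add: sum_f)
  qed
  then have "(\<Sum>s\<in>set_pmf p. expectation (sample_pmf n p)
      (\<lambda>A. \<bar>real (count A s) - real (size A) * pmf p s\<bar>)) \<le> (\<Sum>s\<in>set_pmf p. sqrt n)"
    by (intro sum_mono)
  then show ?thesis
    unfolding deviation_def using p
    by (subst Bochner_Integration.integral_sum) (auto simp: integrable_measure_pmf_finite)
qed

section \<open>Matching two samples of the same law\<close>

lemma ex_pairing:
  assumes "size U = size V"
  shows "\<exists>W. image_mset fst W = U \<and> image_mset snd W = V"
proof -
  obtain us vs where "U = mset us" "V = mset vs" by (metis ex_mset)
  with assms have "image_mset fst (mset (zip us vs)) = U \<and> image_mset snd (mset (zip us vs)) = V"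
    by (metis map_fst_zip map_snd_zip mset_map size_mset)
  then show ?thesis by blast
qed

text \<open>The common part is matched with itself at no cost and the rest arbitrarily, each pair
  costing at most \<open>D\<close>. The size of the rest is controlled by comparing both counts of
  an atom with the expected count, which is the same for both because the sizes agree.\<close>

lemma ex_matching:
  assumes p: "finite (set_pmf p)" and A: "size A = size A'" "set_mset A \<subseteq> set_pmf p"
    and A': "set_mset A' \<subseteq> set_pmf p"
    and D: "\<And>x y. x \<in> set_pmf p \<Longrightarrow> y \<in> set_pmf p \<Longrightarrow> dist x y \<le> D"
  shows "\<exists>Z. image_mset fst Z = A \<and> image_mset snd Z = A' \<and>
    cost Z \<le> D * (deviation p A + deviation p A')"
proof -
  have "(A - A') + (A \<inter># A') = A" "(A' - A) + (A \<inter># A') = A'"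
    by (auto simp: multiset_eq_iff min_def)
  with A(1) have "size (A - A') = size (A' - A)"
    by (metis add_right_cancel size_union)
  then obtain W where W: "image_mset fst W = A - A'" "image_mset snd W = A' - A"
    using ex_pairing by blast
  let ?Z = "image_mset (\<lambda>a. (a, a)) (A \<inter># A') + W"
  obtain x where x: "x \<in> set_pmf p" using set_pmf_not_empty by fast
  have D0: "0 \<le> D" using D[OF x x] by simp
  have "cost W \<le> (\<Sum>z\<in>#W. D)"
    unfolding cost_def
  proof (rule sum_mset_mono)
    fix z assume "z \<in># W"
    then have "fst z \<in># A - A'" "snd z \<in># A' - A" using W by (metis image_eqI set_image_mset)+
    then show "dist (fst z) (snd z) \<le> D"
      using A A' by (intro D) (auto dest!: in_diffD)
  qed
  then have "cost W \<le> D * size W" by (simp add: mult.commute)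
  also have "size W = size (A - A')" using W by (metis size_image_mset)
  also have "real (size (A - A')) = (\<Sum>s\<in>set_mset (A - A'). real (count (A - A') s))"
    by (simp add: size_multiset_overloaded_eq)
  also have "\<dots> \<le> (\<Sum>s\<in>set_pmf p. real (count (A - A') s))"
    using A p by (intro sum_mono2) (auto dest: in_diffD)
  also have "\<dots> \<le> (\<Sum>s\<in>set_pmf p. \<bar>real (count A s) - real (size A) * pmf p s\<bar> +
      \<bar>real (count A' s) - real (size A') * pmf p s\<bar>)"
    unfolding A(1) by (intro sum_mono) simp
  finally have "cost W \<le> D * (deviation p A + deviation p A')"
    using D0 by (simp add: deviation_def sum.distrib mult_left_mono)
  then have "cost ?Z \<le> D * (deviation p A + deviation p A')"
    by (simp add: cost_def image_mset.compositionality comp_def)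
  moreover have "image_mset fst ?Z = A" "image_mset snd ?Z = A'"
    using W by (auto simp: image_mset.compositionality comp_def multiset_eq_iff)
  ultimately show ?thesis by blast
qed

section \<open>Limits of means over growing samples\<close>

text \<open>Two independent samples have close means on average, so some point \<open>b n\<close> is
  close to the mean of a random sample of size n. Monotonicity in the sample size keeps
  \<open>b n\<close> close to the means of all larger samples, which makes \<open>b\<close> a Cauchy
  sequence.\<close>

lemma finite_barycenter:
  fixes B :: "nat \<Rightarrow> 'a::complete_space multiset \<Rightarrow> 'a"
  assumes B: "\<And>n. n \<ge> 2 \<Longrightarrow> contracting_mean n (B n)"
    and step: "\<And>n q A. n \<ge> 2 \<Longrightarrow> size A = Suc n \<Longrightarrow>
      real (Suc n) * dist q (B (Suc n) A) \<le> (\<Sum>a\<in>#A. dist q (B n (A - {#a#})))"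
    and p: "finite (set_pmf p)"
  shows "\<exists>b. (\<lambda>n. expectation (sample_pmf n p) (\<lambda>A. dist b (B n A))) \<longlonglongrightarrow> 0"
proof -
  let ?E = "\<lambda>n. expectation (sample_pmf n p)"
  note fin = finite_set_sample_pmf[OF p]
  \<comment> \<open>The averaging inequality is integrated over samples; omitting one draw leaves a
    sample of size n.\<close>
  have mono_Suc: "?E (Suc n) (\<lambda>A. dist q (B (Suc n) A)) \<le> ?E n (\<lambda>A. dist q (B n A))"
    if "n \<ge> 2" for n q
  proof -
    have "Suc n * ?E (Suc n) (\<lambda>A. dist q (B (Suc n) A)) \<le>
        ?E (Suc n) (\<lambda>A. \<Sum>a\<in>#A. dist q (B n (A - {#a#})))"
      unfolding integral_mult_right_zero[symmetric]
      by (intro expectation_mono_finite fin step that size_sample_pmf)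
    also have "\<dots> = Suc n * ?E n (\<lambda>A. dist q (B n A))"
      by (rule expectation_sample_remove[OF p])
    finally show ?thesis by (simp del: of_nat_Suc sample_pmf.simps)
  qed
  have mono: "?E m (\<lambda>A. dist q (B m A)) \<le> ?E n (\<lambda>A. dist q (B n A))"
    if "n \<ge> 2" "n \<le> m" for n m q
    using that(2)
  proof (induction rule: dec_induct)
    case (step k)
    then show ?case using mono_Suc[of k q] that(1) by simp
  qed simp
  define D where "D = (\<Sum>x\<in>set_pmf p. \<Sum>y\<in>set_pmf p. dist x y)"
  have D: "dist x y \<le> D" if "x \<in> set_pmf p" "y \<in> set_pmf p" for x y
  proof -
    have "dist x y \<le> (\<Sum>y\<in>set_pmf p. dist x y)" using p that by (intro member_le_sum) auto
    also have "\<dots> \<le> D" unfolding D_def using p that by (intro member_le_sum) (auto intro: sum_nonneg)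
    finally show ?thesis .
  qed
  have "0 \<le> D" unfolding D_def by (intro sum_nonneg) auto
  \<comment> \<open>The factor 2 counts the two samples, each with expected deviation at most
    \<open>card (set_pmf p) * sqrt n\<close>, and \<open>D\<close> bounds the diameter of the
    support. Division by n leaves the rate 1 / sqrt n.\<close>
  define c where "c = 2 * D * card (set_pmf p)"
  define a where "a n = c / sqrt (real n)" for n :: nat
  have near: "\<exists>b. ?E n (\<lambda>A. dist b (B n A)) \<le> a n" if "n \<ge> 2" for n
  proof -
    have "n * ?E n (\<lambda>A. ?E n (\<lambda>A'. dist (B n A) (B n A'))) \<le>
        ?E n (\<lambda>A. ?E n (\<lambda>A'. D * deviation p A + D * deviation p A'))"
      unfolding integral_mult_right_zero[symmetric]
    proof (intro expectation_mono_finite fin)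
      fix A A' assume AA: "A \<in> set_pmf (sample_pmf n p)" "A' \<in> set_pmf (sample_pmf n p)"
      obtain Z where Z: "image_mset fst Z = A" "image_mset snd Z = A'"
        "cost Z \<le> D * (deviation p A + deviation p A')"
        using ex_matching[OF p _ _ _ D, of A A'] AA size_sample_pmf set_mset_sample_pmf by metis
      have "size Z = n" using Z(1) size_sample_pmf[OF AA(1)] by auto
      then have "n * dist (B n A) (B n A') \<le> cost Z"
        using B[OF that] Z by (auto simp: contracting_mean_def)
      with Z(3) show "n * dist (B n A) (B n A') \<le> D * deviation p A + D * deviation p A'"
        by (simp add: algebra_simps)
    qed
    also have "\<dots> = 2 * D * ?E n (deviation p)"
      by (simp add: expectation_add_finite[OF fin])
    also have "\<dots> \<le> 2 * D * (card (set_pmf p) * sqrt n)"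
      using expectation_deviation[OF p] \<open>0 \<le> D\<close> by (intro mult_left_mono) auto
    finally have "n * ?E n (\<lambda>A. ?E n (\<lambda>A'. dist (B n A) (B n A'))) \<le> c * sqrt n"
      by (simp add: c_def)
    then have "sqrt n * (sqrt n * ?E n (\<lambda>A. ?E n (\<lambda>A'. dist (B n A) (B n A')))) \<le> sqrt n * c"
      by (simp add: mult.commute flip: mult.assoc)
    then have *: "?E n (\<lambda>A. ?E n (\<lambda>A'. dist (B n A) (B n A'))) \<le> a n"
      using that unfolding a_def by (simp add: pos_le_divide_eq mult.commute)
    \<comment> \<open>Some value of the inner expectation does not exceed its average;
      \<open>B n A\<close> for such an \<open>A\<close> is the point sought.\<close>
    have "\<exists>A. ?E n (\<lambda>A'. dist (B n A) (B n A')) \<le> a n"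
    proof (rule ccontr)
      assume "\<not> ?thesis"
      then have "a n < ?E n (\<lambda>A'. dist (B n A) (B n A'))" for A by (auto simp: not_le)
      then have "?E n (\<lambda>A. a n) < ?E n (\<lambda>A. ?E n (\<lambda>A'. dist (B n A) (B n A')))"
        using fin by (intro measure_pmf.integral_less_AE_space)
          (auto simp: integrable_measure_pmf_finite measure_pmf.emeasure_space_1)
      with * show False by simp
    qed
    then show ?thesis by blast
  qed
  then obtain b where b: "\<And>n. n \<ge> 2 \<Longrightarrow> ?E n (\<lambda>A. dist (b n) (B n A)) \<le> a n" by metis
  have a_decseq: "a m \<le> a n" if "2 \<le> n" "n \<le> m" for m n
    using that \<open>0 \<le> D\<close> by (simp add: a_def c_def frac_le)
  have a_lim: "a \<longlonglongrightarrow> 0"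
    unfolding a_def by real_asymp
  \<comment> \<open>Both points are compared with the mean of a sample of the larger size
    \<open>m\<close>: \<open>b m\<close> by its choice, \<open>b n\<close> by monotonicity.\<close>
  have b_dist: "dist (b n) (b m) \<le> 2 * a n" if "2 \<le> n" "n \<le> m" for m n
  proof -
    have "?E m (\<lambda>A. dist (b n) (b m)) \<le> ?E m (\<lambda>A. dist (b n) (B m A) + dist (b m) (B m A))"
      by (intro expectation_mono_finite fin) (metis dist_commute dist_triangle)
    also have "\<dots> \<le> a n + a m"
      unfolding expectation_add_finite[OF fin]
      using mono[OF that, of "b n"] b[of n] b[of m] that by (intro add_mono) auto
    finally show ?thesis using a_decseq[OF that] by simp
  qed
  have "Cauchy b"
  proof (rule metric_CauchyI)
    fix e :: real assume "0 < e"
    with a_lim have "\<forall>\<^sub>F n in sequentially. a n < e / 4"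
      by (intro order_tendstoD(2)[where a = "e/4"]) auto
    with eventually_ge_at_top[of 2] have "\<forall>\<^sub>F n in sequentially. 2 \<le> n \<and> a n < e / 4"
      by eventually_elim simp
    then obtain n where n: "2 \<le> n" "a n < e / 4" by (auto simp: eventually_sequentially)
    have "dist (b i) (b j) < e" if "i \<ge> n" "j \<ge> n" for i j
      using b_dist[OF n(1) that(1)] b_dist[OF n(1) that(2)] n(2) dist_triangle2[of "b i" "b j" "b n"]
      by (simp add: dist_commute)
    then show "\<exists>M. \<forall>i\<ge>M. \<forall>j\<ge>M. dist (b i) (b j) < e" by blast
  qed
  then obtain l where l: "b \<longlonglongrightarrow> l" using Cauchy_convergent convergent_def by blast
  have "(\<lambda>n. ?E n (\<lambda>A. dist l (B n A))) \<longlonglongrightarrow> 0"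
  proof (rule tendsto_sandwich[OF _ _ tendsto_const])
    have "?E n (\<lambda>A. dist l (B n A)) \<le> dist l (b n) + a n" if "2 \<le> n" for n
    proof -
      have "?E n (\<lambda>A. dist l (B n A)) \<le> ?E n (\<lambda>A. dist l (b n) + dist (b n) (B n A))"
        by (intro expectation_mono_finite fin) (rule dist_triangle)
      also have "\<dots> \<le> dist l (b n) + a n"
        unfolding expectation_add_finite[OF fin] using b[OF that] by simp
      finally show ?thesis .
    qed
    then show "\<forall>\<^sub>F n in sequentially. ?E n (\<lambda>A. dist l (B n A)) \<le> dist l (b n) + a n"
      by (auto simp: eventually_sequentially)
    have "(\<lambda>n. dist l (b n) + a n) \<longlonglongrightarrow> dist l l + 0"
      by (intro tendsto_intros l a_lim)
    then show "(\<lambda>n. dist l (b n) + a n) \<longlonglongrightarrow> 0" by simp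
  qed auto
  then show ?thesis by blast
qed

text \<open>A sample of \<open>p\<close> matches samples of its marginals, and the expected matching
  cost per draw is the cost of \<open>p\<close>. The contraction property of the means then passes
  to the limit.\<close>

lemma finite_barycenter_map:
  fixes \<sigma> :: "'a::complete_space \<Rightarrow> 'a \<Rightarrow> real \<Rightarrow> 'a"
  assumes "conical_bicombing \<sigma>"
  obtains \<beta> :: "'a pmf \<Rightarrow> 'a"
  where "\<And>x. \<beta> (return_pmf x) = x"
    and "\<And>p. finite (set_pmf p) \<Longrightarrow>
      dist (\<beta> (map_pmf fst p)) (\<beta> (map_pmf snd p)) \<le> expectation p (\<lambda>z. dist (fst z) (snd z))"
proof -
  obtain B :: "nat \<Rightarrow> 'a multiset \<Rightarrow> 'a" where B: "\<And>n. n \<ge> 2 \<Longrightarrow> contracting_mean n (B n)"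
    and step: "\<And>n q A. n \<ge> 2 \<Longrightarrow> size A = Suc n \<Longrightarrow>
      real (Suc n) * dist q (B (Suc n) A) \<le> (\<Sum>a\<in>#A. dist q (B n (A - {#a#})))"
    using contracting_means[OF assms] by metis
  define \<beta> where "\<beta> p = (SOME b. (\<lambda>n. expectation (sample_pmf n p) (\<lambda>A. dist b (B n A))) \<longlonglongrightarrow> 0)" for p
  have \<beta>: "(\<lambda>n. expectation (sample_pmf n p) (\<lambda>A. dist (\<beta> p) (B n A))) \<longlonglongrightarrow> 0"
    if "finite (set_pmf p)" for p
    unfolding \<beta>_def using finite_barycenter[OF B step that] by (rule someI_ex)
  show ?thesis
  proof
    fix x :: 'a
    have "(\<lambda>n. expectation (sample_pmf n (return_pmf x)) (\<lambda>A. dist (\<beta> (return_pmf x)) (B n A)))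
        \<longlonglongrightarrow> dist (\<beta> (return_pmf x)) x"
    proof (rule tendsto_eventually)
      show "\<forall>\<^sub>F n in sequentially. expectation (sample_pmf n (return_pmf x))
          (\<lambda>A. dist (\<beta> (return_pmf x)) (B n A)) = dist (\<beta> (return_pmf x)) x"
        using eventually_ge_at_top[of 2]
        by eventually_elim (use B in \<open>simp add: sample_return_pmf contracting_mean_def\<close>)
    qed
    with \<beta>[of "return_pmf x"] show "\<beta> (return_pmf x) = x"
      by (auto dest: LIMSEQ_unique)
  next
    fix p :: "('a \<times> 'a) pmf" assume p: "finite (set_pmf p)"
    let ?E = "\<lambda>n. expectation (sample_pmf n p)"
    let ?b = "\<beta> (map_pmf fst p)" and ?b' = "\<beta> (map_pmf snd p)"
    let ?c = "expectation p (\<lambda>z. dist (fst z) (snd z))"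
    let ?f = "\<lambda>n. ?E n (\<lambda>Z. dist ?b (B n (image_mset fst Z)))"
    let ?g = "\<lambda>n. ?E n (\<lambda>Z. dist ?b' (B n (image_mset snd Z)))"
    note fin = finite_set_sample_pmf[OF p]
    have "dist ?b ?b' \<le> (?f n + ?c) + ?g n" if n: "n \<ge> 2" for n
    proof -
      have "?E n (\<lambda>Z. dist ?b ?b') \<le> ?E n (\<lambda>Z. (dist ?b (B n (image_mset fst Z)) + 1 / n * cost Z) +
          dist ?b' (B n (image_mset snd Z)))"
      proof (intro expectation_mono_finite fin)
        fix Z assume "Z \<in> set_pmf (sample_pmf n p)"
        then have "n * dist (B n (image_mset fst Z)) (B n (image_mset snd Z)) \<le> cost Z"
          using B[OF n] by (auto simp: contracting_mean_def dest: size_sample_pmf)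
        then have "dist (B n (image_mset fst Z)) (B n (image_mset snd Z)) \<le> 1 / n * cost Z"
          using n by (simp add: field_simps)
        then show "dist ?b ?b' \<le> (dist ?b (B n (image_mset fst Z)) + 1 / n * cost Z) +
            dist ?b' (B n (image_mset snd Z))"
          using dist_triangle[of ?b ?b' "B n (image_mset fst Z)"]
            dist_triangle2[of "B n (image_mset fst Z)" ?b' "B n (image_mset snd Z)"]
          by linarith
      qed
      also have "\<dots> = (?f n + 1 / n * (n * ?c)) + ?g n"
        unfolding expectation_add_finite[OF fin] integral_mult_right_zero cost_def
          expectation_sample_sum[OF p] ..
      finally show ?thesis using n by simp
    qed
    then have "\<exists>N. \<forall>n\<ge>N. dist ?b ?b' \<le> (?f n + ?c) + ?g n" by blast
    moreover have "(\<lambda>n. (?f n + ?c) + ?g n) \<longlonglongrightarrow> (0 + ?c) + 0"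
      using \<beta>[of "map_pmf fst p"] \<beta>[of "map_pmf snd p"] p
      by (intro tendsto_intros) (simp_all add: sample_map_pmf)
    ultimately show "dist ?b ?b' \<le> ?c"
      using LIMSEQ_le_const by fastforce
  qed
qed

section \<open>Barycenters of Radon measures\<close>

text \<open>Only meaningful for simple functions on a probability space.\<close>

definition law :: "'b measure \<Rightarrow> ('b \<Rightarrow> 'a) \<Rightarrow> 'a pmf" where
  "law M \<phi> = Abs_pmf (distr M (count_space UNIV) \<phi>)"

text \<open>The finite range makes the image measure discrete, as \<open>Abs_pmf\<close>
  requires.\<close>

lemma measure_pmf_law:
  assumes M: "prob_space M" and \<phi>: "simple_function M \<phi>"
  shows "measure_pmf (law M \<phi>) = distr M (count_space UNIV) \<phi>"
proof -
  let ?D = "distr M (count_space UNIV) \<phi>"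
  interpret D: prob_space ?D
    using M measurable_simple_function[OF \<phi>] by (rule prob_space.prob_space_distr)
  have "AE y in ?D. y \<in> \<phi> ` space M"
    by (subst AE_distr_iff) (auto simp: measurable_simple_function[OF \<phi>])
  then have "AE y in ?D. measure ?D {y} \<noteq> 0"
    using countable_finite[OF simple_functionD(1)[OF \<phi>]]
    by (subst D.AE_support_countable) auto
  then show ?thesis
    unfolding law_def by (intro Abs_pmf_inverse) (auto simp: D.prob_space_axioms)
qed

lemma set_pmf_law:
  assumes "prob_space M" and \<phi>: "simple_function M \<phi>"
  shows "set_pmf (law M \<phi>) \<subseteq> \<phi> ` space M"
proof
  fix y assume "y \<in> set_pmf (law M \<phi>)"
  then have "measure M (\<phi> -` {y} \<inter> space M) \<noteq> 0"
    by (simp add: set_pmf_iff pmf.rep_eq measure_pmf_law[OF assms] measure_distr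
        measurable_simple_function[OF \<phi>])
  then show "y \<in> \<phi> ` space M" by (cases "\<phi> -` {y} \<inter> space M = {}") auto
qed

lemma finite_set_pmf_law:
  "prob_space M \<Longrightarrow> simple_function M \<phi> \<Longrightarrow> finite (set_pmf (law M \<phi>))"
  using set_pmf_law finite_subset simple_functionD(1) by metis

lemma map_pmf_law:
  assumes M: "prob_space M" and \<phi>: "simple_function M \<phi>"
  shows "map_pmf f (law M \<phi>) = law M (\<lambda>x. f (\<phi> x))"
proof -
  have "simple_function M (\<lambda>x. f (\<phi> x))" using \<phi> simple_function_compose[OF \<phi>, of f] by (simp add: comp_def)
  then have "measure_pmf (map_pmf f (law M \<phi>)) = measure_pmf (law M (\<lambda>x. f (\<phi> x)))"
    using M \<phi> by (simp add: map_pmf_rep_eq measure_pmf_law distr_distr comp_def measurable_simple_function)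
  then show ?thesis by (simp add: measure_pmf_inject)
qed

lemma expectation_law:
  assumes "prob_space M" "simple_function M \<phi>" "\<And>x. 0 \<le> f x"
  shows "ennreal (expectation (law M \<phi>) f) = (\<integral>\<^sup>+x. ennreal (f (\<phi> x)) \<partial>M)"
proof -
  have "ennreal (expectation (law M \<phi>) f) = (\<integral>\<^sup>+y. ennreal (f y) \<partial>law M \<phi>)"
    using assms by (intro nn_integral_eq_integral[symmetric])
      (auto simp: integrable_measure_pmf_finite finite_set_pmf_law)
  then show ?thesis
    using assms by (simp add: measure_pmf_law nn_integral_distr measurable_simple_function)
qed

lemma law_const: "prob_space M \<Longrightarrow> law M (\<lambda>_. x) = return_pmf x"
  using set_pmf_law[of M "\<lambda>_. x"] by (subst set_pmf_subset_singleton[symmetric]) auto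

lemma law_distr:
  assumes f: "f \<in> measurable M borel" and \<phi>: "simple_function borel \<phi>"
  shows "law (distr M borel f) \<phi> = law M (\<lambda>x. \<phi> (f x))"
  unfolding law_def
  by (subst distr_distr) (auto simp: comp_def f intro!: measurable_simple_function \<phi>)

section \<open>Approximating measures by their images under simple functions\<close>

lemma borel_measurable_dist_const:
  fixes y :: "'a::metric_space"
  shows "(\<lambda>x. dist x y) \<in> borel_measurable borel"
  by (intro borel_measurable_continuous_onI continuous_intros)

lemma borel_measurable_ennreal_dist:
  fixes y :: "'a::metric_space"
  shows "(\<lambda>x. ennreal (dist x y)) \<in> borel_measurable borel"
  by (rule measurable_compose[OF borel_measurable_dist_const measurable_ennreal])

text \<open>Without second countability \<open>dist\<close> need not be measurable for the product
  of the Borel sigma-algebras. Splitting along the finitely many values of \<phi> reduces the claim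
  to distances from fixed points.\<close>

lemma borel_measurable_dist_simple:
  fixes \<phi> :: "'a::metric_space \<Rightarrow> 'a"
  assumes \<phi>: "simple_function borel \<phi>"
  shows "(\<lambda>x. dist x (\<phi> x)) \<in> borel_measurable borel"
proof (rule measurable_compose_countable'[of "range \<phi>" "\<lambda>y x. dist x y" _ _ \<phi>])
  show "(\<lambda>x. dist x y) \<in> borel_measurable borel" for y :: 'a
    by (rule borel_measurable_dist_const)
  have "finite (range \<phi>)" using simple_functionD(1)[OF \<phi>] by simp
  then show "countable (range \<phi>)" by (rule countable_finite)
  show "\<phi> \<in> measurable borel (count_space (range \<phi>))"
    using measurable_simple_function[OF \<phi>] by (auto simp: measurable_def)
qed

text \<open>The cost of transporting \<mu> along \<phi>; it measures the quality of the law of a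
  simple \<phi> as an approximation of \<mu>.\<close>

definition displacement :: "'a::metric_space measure \<Rightarrow> ('a \<Rightarrow> 'a) \<Rightarrow> ennreal" where
  "displacement \<mu> \<phi> = (\<integral>\<^sup>+x. ennreal (dist x (\<phi> x)) \<partial>\<mu>)"

text \<open>Send each covered point to the centre of a ball that contains it.\<close>

lemma ex_simple_function_near:
  fixes k :: "'a::metric_space set"
  assumes "finite k"
  shows "\<exists>\<phi>. simple_function borel \<phi> \<and> (\<forall>x\<in>(\<Union>c\<in>k. ball c e). dist x (\<phi> x) < e)"
  using assms
proof (induction k)
  case empty
  show ?case by (rule exI[of _ "\<lambda>_. undefined"]) simp
next
  case (insert c k)
  then obtain \<phi> where \<phi>: "simple_function borel \<phi>" "\<forall>x\<in>(\<Union>c\<in>k. ball c e). dist x (\<phi> x) < e"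
    by blast
  then have "simple_function borel (\<lambda>x. if x \<in> ball c e then c else \<phi> x)"
    by (intro simple_function_If_set) auto
  moreover have "\<forall>x\<in>(\<Union>c\<in>insert c k. ball c e). dist x (if x \<in> ball c e then c else \<phi> x) < e"
    using \<phi>(2) by (auto simp: dist_commute)
  ultimately show ?case by blast
qed

text \<open>Inner regularity gives compact sets whose complements have arbitrarily small measure.
  Dominated convergence, with the integrable distance from \<open>x\<^sub>0\<close> as majorant,
  turns this into a small moment.\<close>

lemma P1_tight_moment:
  fixes \<mu> :: "'a::metric_space measure"
  assumes \<mu>: "\<mu> \<in> P1" and "0 < e"
  obtains K x\<^sub>0 where "compact K"
    "(\<integral>\<^sup>+x. ennreal (dist x x\<^sub>0) * indicator (- K) x \<partial>\<mu>) < ennreal e"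
proof -
  obtain x\<^sub>0 where moment: "(\<integral>\<^sup>+ x. ennreal (dist x x\<^sub>0) \<partial>\<mu>) < \<infinity>"
    and sets: "sets \<mu> = sets borel" and "prob_space \<mu>"
    and radon: "\<And>B. B \<in> sets borel \<Longrightarrow> emeasure \<mu> B = (SUP K\<in>{K. compact K \<and> K \<subseteq> B}. emeasure \<mu> K)"
    using \<mu> by (auto simp: P1_def radon_prob_def)
  interpret prob_space \<mu> by fact
  have space: "space \<mu> = UNIV" using sets_eq_imp_space_eq[OF sets] by simp
  have borel_eq: "measurable \<mu> M = measurable borel M" for M :: "'c measure"
    using measurable_cong_sets[OF sets refl] .
  have compl_small: "\<exists>K. compact K \<and> emeasure \<mu> (- K) < ennreal d" if "0 < d" for d
  proof -
    have "emeasure \<mu> UNIV = 1" using emeasure_space_1 space by simp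
    then have "1 - ennreal d < (SUP K\<in>{K. compact K \<and> K \<subseteq> UNIV}. emeasure \<mu> K)"
      using radon[of UNIV] ennreal_between[of "ennreal d" 1] that by simp
    then obtain K where K: "compact K" "1 - ennreal d < emeasure \<mu> K" by (auto simp: less_SUP_iff)
    have "ennreal (1 - d) < ennreal (prob K)"
      using K(2) that ennreal_minus[of d 1] by (simp add: emeasure_eq_measure)
    then have "1 - d < prob K" by (meson ennreal_leI not_le)
    moreover have "K \<in> events" using K(1) sets by (simp add: borel_compact)
    then have "prob (- K) = 1 - prob K"
      using prob_compl[of K] space by (simp add: Compl_eq_Diff_UNIV)
    ultimately have "emeasure \<mu> (- K) < ennreal d"
      using that by (simp add: emeasure_eq_measure ennreal_lessI)
    with K(1) show ?thesis by blast
  qed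
  then have "\<forall>n. \<exists>K. compact K \<and> emeasure \<mu> (- K) < ennreal (1 / Suc n)" by simp
  then obtain K where K: "\<And>n. compact (K n)" "\<And>n. emeasure \<mu> (- K n) < ennreal (1 / Suc n)"
    by metis
  \<comment> \<open>The sets \<open>K n\<close> need not be nested; in these increasing unions a
    point stays once it has entered.\<close>
  define L where "L n = (\<Union>i\<le>n. K i)" for n
  have L: "compact (L n)" for n unfolding L_def using K(1) by (intro compact_UN) auto
  have L_sets: "L n \<in> sets borel" and K_sets: "K n \<in> sets borel" for n
    using L K(1) by (simp_all add: borel_compact)
  have "emeasure \<mu> (\<Inter>n. - K n) = 0"
  proof (rule ccontr)
    assume *: "emeasure \<mu> (\<Inter>n. - K n) \<noteq> 0"
    have "emeasure \<mu> (\<Inter>n. - K n) \<le> ennreal (1 / Suc n)" for n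
      using K_sets sets by (intro order_trans[OF emeasure_mono less_imp_le[OF K(2)[of n]]]) auto
    moreover have "(\<lambda>n. ennreal (1 / Suc n)) \<longlonglongrightarrow> ennreal 0"
      by (intro tendsto_ennrealI) (use LIMSEQ_inverse_real_of_nat in \<open>simp add: inverse_eq_divide\<close>)
    ultimately have "emeasure \<mu> (\<Inter>n. - K n) \<le> ennreal 0"
      by (intro LIMSEQ_le_const) auto
    with * show False by simp
  qed
  then have "(\<Inter>n. - K n) \<in> null_sets \<mu>"
    using K_sets sets by (intro null_setsI) auto
  then have ae: "AE x in \<mu>. x \<in> (\<Union>n. K n)"
    by (rule AE_I'[of "\<Inter>n. - K n"]) auto
  have "(\<lambda>n. \<integral>\<^sup>+x. ennreal (dist x x\<^sub>0) * indicator (- L n) x \<partial>\<mu>) \<longlonglongrightarrow> (\<integral>\<^sup>+x. 0 \<partial>\<mu>)"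
  proof (rule nn_integral_dominated_convergence[where w = "\<lambda>x. ennreal (dist x x\<^sub>0)"])
    show d: "(\<lambda>x. ennreal (dist x x\<^sub>0)) \<in> borel_measurable \<mu>"
      unfolding borel_eq by (rule borel_measurable_ennreal_dist)
    show "(\<lambda>x. ennreal (dist x x\<^sub>0) * indicator (- L n) x) \<in> borel_measurable \<mu>" for n
      using L_sets[of n] sets d by (intro borel_measurable_times_ennreal borel_measurable_indicator) auto
    show "AE x in \<mu>. ennreal (dist x x\<^sub>0) * indicator (- L n) x \<le> ennreal (dist x x\<^sub>0)" for n
      by (auto simp: indicator_def)
    show "AE x in \<mu>. (\<lambda>n. ennreal (dist x x\<^sub>0) * indicator (- L n) x) \<longlonglongrightarrow> 0"
      using ae
    proof eventually_elim
      case (elim x)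
      then obtain m where "x \<in> K m" by blast
      then have "\<forall>n\<ge>m. ennreal (dist x x\<^sub>0) * indicator (- L n) x = 0" by (auto simp: L_def indicator_def)
      then show ?case by (intro tendsto_eventually) (auto simp: eventually_sequentially)
    qed
  qed (use moment in auto)
  then have "\<forall>\<^sub>F n in sequentially. (\<integral>\<^sup>+x. ennreal (dist x x\<^sub>0) * indicator (- L n) x \<partial>\<mu>) < ennreal e"
    using \<open>0 < e\<close> by (intro order_tendstoD(2)) auto
  then obtain n where "(\<integral>\<^sup>+x. ennreal (dist x x\<^sub>0) * indicator (- L n) x \<partial>\<mu>) < ennreal e"
    by (auto simp: eventually_sequentially)
  with L show ?thesis by (rule that)
qed

text \<open>Half of \<open>e\<close> is spent on a compact set, approximated by the centres of a
  finite cover, and half outside it, where every point is sent to \<open>x\<^sub>0\<close>.\<close>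

lemma P1_ex_simple_function:
  fixes \<mu> :: "'a::metric_space measure"
  assumes \<mu>: "\<mu> \<in> P1" and "0 < e"
  shows "\<exists>\<phi>. simple_function borel \<phi> \<and> displacement \<mu> \<phi> \<le> ennreal e"
proof -
  have sets: "sets \<mu> = sets borel" and "prob_space \<mu>"
    using \<mu> by (auto simp: P1_def radon_prob_def)
  interpret prob_space \<mu> by fact
  have borel_eq: "measurable \<mu> M = measurable borel M" for M :: "'c measure"
    using measurable_cong_sets[OF sets refl] .
  obtain K x\<^sub>0 where K: "compact K"
    and out: "(\<integral>\<^sup>+x. ennreal (dist x x\<^sub>0) * indicator (- K) x \<partial>\<mu>) < ennreal (e / 2)"
    using P1_tight_moment[OF \<mu>, of "e / 2"] \<open>0 < e\<close> by auto
  obtain k where k: "finite k" "K \<subseteq> (\<Union>c\<in>k. ball c (e / 2))"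
    using K \<open>0 < e\<close> unfolding compact_eq_totally_bounded by (metis half_gt_zero)
  obtain \<phi> where \<phi>: "simple_function borel \<phi>" "\<And>x. x \<in> K \<Longrightarrow> dist x (\<phi> x) < e / 2"
    using ex_simple_function_near[OF k(1), of "e / 2"] k(2) by blast
  define \<psi> where "\<psi> x = (if x \<in> K then \<phi> x else x\<^sub>0)" for x
  have K_sets: "K \<in> sets borel" using K by (rule borel_compact)
  have \<psi>: "simple_function borel \<psi>"
    unfolding \<psi>_def using \<phi>(1) K_sets by (intro simple_function_If_set) auto
  have "displacement \<mu> \<psi> \<le> (\<integral>\<^sup>+x. ennreal (e / 2) + ennreal (dist x x\<^sub>0) * indicator (- K) x \<partial>\<mu>)"
    unfolding displacement_def
    using \<phi>(2) \<open>0 < e\<close> by (intro nn_integral_mono) (auto simp: \<psi>_def indicator_def ennreal_leI less_imp_le)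
  also have "\<dots> = ennreal (e / 2) + (\<integral>\<^sup>+x. ennreal (dist x x\<^sub>0) * indicator (- K) x \<partial>\<mu>)"
  proof (subst nn_integral_add)
    show "(\<lambda>x. ennreal (dist x x\<^sub>0) * indicator (- K) x) \<in> borel_measurable \<mu>"
      unfolding borel_eq using K_sets borel_measurable_ennreal_dist
      by (intro borel_measurable_times_ennreal borel_measurable_indicator) auto
  qed (auto simp: emeasure_space_1)
  also have "\<dots> \<le> ennreal (e / 2) + ennreal (e / 2)"
    using out by (intro add_left_mono) auto
  also have "\<dots> = ennreal e" using \<open>0 < e\<close> by (simp flip: ennreal_plus)
  finally show ?thesis using \<psi> by blast
qed

section \<open>Extension of barycenters to measures in \<open>P1\<close>\<close>

text \<open>The joint law of \<open>\<phi> (f x)\<close> and \<open>\<psi> (g x)\<close> is a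
  finitely supported coupling, and the triangle inequality splits its cost. A general space
  \<open>M\<close> covers both a coupling with its two projections and a single measure with
  \<open>f\<close> and \<open>g\<close> the identity. Measurability of the distance is assumed
  because outside second countable spaces it need not follow from that of \<open>f\<close> and
  \<open>g\<close>.\<close>

lemma dist_barycenters_le:
  fixes \<beta> :: "'a::metric_space pmf \<Rightarrow> 'a"
  assumes \<beta>: "\<And>p. finite (set_pmf p) \<Longrightarrow>
      dist (\<beta> (map_pmf fst p)) (\<beta> (map_pmf snd p)) \<le> expectation p (\<lambda>z. dist (fst z) (snd z))"
    and M: "prob_space M" and f: "f \<in> measurable M borel" and g: "g \<in> measurable M borel"
    and d: "(\<lambda>x. dist (f x) (g x)) \<in> borel_measurable M"
    and \<phi>: "simple_function borel \<phi>" and \<psi>: "simple_function borel \<psi>"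
  shows "ennreal (dist (\<beta> (law (distr M borel f) \<phi>)) (\<beta> (law (distr M borel g) \<psi>))) \<le>
    displacement (distr M borel f) \<phi> + (\<integral>\<^sup>+x. ennreal (dist (f x) (g x)) \<partial>M) +
    displacement (distr M borel g) \<psi>"
proof -
  let ?\<chi> = "\<lambda>x. (\<phi> (f x), \<psi> (g x))"
  have \<phi>f: "simple_function M (\<lambda>x. \<phi> (f x))" and \<psi>g: "simple_function M (\<lambda>x. \<psi> (g x))"
    using simple_function_comp[OF f \<phi>] simple_function_comp[OF g \<psi>] .
  then have \<chi>: "simple_function M ?\<chi>" by (rule simple_function_Pair)
  have disp: "displacement (distr M borel h) \<theta> = (\<integral>\<^sup>+x. ennreal (dist (h x) (\<theta> (h x))) \<partial>M)"
    and meas: "(\<lambda>x. ennreal (dist (h x) (\<theta> (h x)))) \<in> borel_measurable M"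
    if h: "h \<in> measurable M borel" and \<theta>: "simple_function borel \<theta>" for h and \<theta> :: "'a \<Rightarrow> 'a"
  proof -
    have "(\<lambda>x. ennreal (dist x (\<theta> x))) \<in> borel_measurable borel"
      using borel_measurable_dist_simple[OF \<theta>] by measurable
    then show "displacement (distr M borel h) \<theta> = (\<integral>\<^sup>+x. ennreal (dist (h x) (\<theta> (h x))) \<partial>M)"
      "(\<lambda>x. ennreal (dist (h x) (\<theta> (h x)))) \<in> borel_measurable M"
      unfolding displacement_def using h by (auto intro: nn_integral_distr)
  qed
  have "dist (\<beta> (law M (\<lambda>x. \<phi> (f x)))) (\<beta> (law M (\<lambda>x. \<psi> (g x)))) \<le>
      expectation (law M ?\<chi>) (\<lambda>z. dist (fst z) (snd z))"
    using \<beta>[OF finite_set_pmf_law[OF M \<chi>]] by (simp add: map_pmf_law[OF M \<chi>])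
  then have "ennreal (dist (\<beta> (law M (\<lambda>x. \<phi> (f x)))) (\<beta> (law M (\<lambda>x. \<psi> (g x))))) \<le>
      ennreal (expectation (law M ?\<chi>) (\<lambda>z. dist (fst z) (snd z)))"
    by (rule ennreal_leI)
  also have "\<dots> = (\<integral>\<^sup>+x. ennreal (dist (\<phi> (f x)) (\<psi> (g x))) \<partial>M)"
    using expectation_law[OF M \<chi>, of "\<lambda>z. dist (fst z) (snd z)"] by simp
  also have "\<dots> \<le> (\<integral>\<^sup>+x. ennreal (dist (f x) (\<phi> (f x))) + ennreal (dist (f x) (g x)) +
      ennreal (dist (g x) (\<psi> (g x))) \<partial>M)"
  proof (rule nn_integral_mono)
    fix x
    have "dist (\<phi> (f x)) (\<psi> (g x)) \<le> dist (f x) (\<phi> (f x)) + dist (f x) (g x) + dist (g x) (\<psi> (g x))"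
      using dist_triangle[of "\<phi> (f x)" "\<psi> (g x)" "f x"] dist_triangle[of "f x" "\<psi> (g x)" "g x"]
      by (simp add: dist_commute)
    then show "ennreal (dist (\<phi> (f x)) (\<psi> (g x))) \<le> ennreal (dist (f x) (\<phi> (f x))) +
        ennreal (dist (f x) (g x)) + ennreal (dist (g x) (\<psi> (g x)))"
      by (simp add: ennreal_leI flip: ennreal_plus)
  qed
  also have "\<dots> = displacement (distr M borel f) \<phi> + (\<integral>\<^sup>+x. ennreal (dist (f x) (g x)) \<partial>M) +
      displacement (distr M borel g) \<psi>"
    using meas[OF f \<phi>] meas[OF g \<psi>] d by (simp add: nn_integral_add disp f g \<phi> \<psi>)
  finally show ?thesis by (simp add: law_distr f g \<phi> \<psi>)
qed

text \<open>Simple approximations with vanishing displacement have Cauchy barycenters. Testing the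
  limit against all simple functions frees the conclusion from the approximating sequence. The
  hypothesis \<open>approx\<close> replaces membership in \<open>P1\<close>, so Dirac measures can
  be treated directly.\<close>

lemma ex_barycenter:
  fixes \<beta> :: "'a::complete_space pmf \<Rightarrow> 'a"
  assumes \<beta>: "\<And>p. finite (set_pmf p) \<Longrightarrow>
      dist (\<beta> (map_pmf fst p)) (\<beta> (map_pmf snd p)) \<le> expectation p (\<lambda>z. dist (fst z) (snd z))"
    and \<mu>: "prob_space \<mu>" "sets \<mu> = sets borel"
    and approx: "\<And>e. 0 < e \<Longrightarrow> \<exists>\<phi>. simple_function borel \<phi> \<and> displacement \<mu> \<phi> \<le> ennreal e"
  shows "\<exists>b. \<forall>\<phi>. simple_function borel \<phi> \<longrightarrow>
    ennreal (dist b (\<beta> (law \<mu> \<phi>))) \<le> displacement \<mu> \<phi>"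
proof -
  have id: "(\<lambda>x. x) \<in> measurable \<mu> borel" "distr \<mu> borel (\<lambda>x. x) = \<mu>"
    using \<mu>(2) by (auto simp: distr_id2)
  \<comment> \<open>Both maps on the space are the identity, so the middle term of the estimate is
    zero.\<close>
  have two: "ennreal (dist (\<beta> (law \<mu> \<phi>)) (\<beta> (law \<mu> \<psi>))) \<le> displacement \<mu> \<phi> + displacement \<mu> \<psi>"
    if "simple_function borel \<phi>" "simple_function borel \<psi>" for \<phi> \<psi>
    using dist_barycenters_le[OF \<beta> \<mu>(1) id(1) id(1) _ that] by (simp add: id(2))
  define e where "e n = 1 / real (Suc n)" for n
  have e: "0 < e n" for n by (simp add: e_def)
  have e_lim: "e \<longlonglongrightarrow> 0"
    unfolding e_def using LIMSEQ_inverse_real_of_nat by (simp add: inverse_eq_divide)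
  obtain \<phi> where \<phi>: "\<And>n. simple_function borel (\<phi> n)" "\<And>n. displacement \<mu> (\<phi> n) \<le> ennreal (e n)"
    using approx[OF e] by metis
  define b where "b n = \<beta> (law \<mu> (\<phi> n))" for n
  have b_dist: "dist (b n) (b m) \<le> e n + e m" for n m
  proof -
    have "ennreal (dist (b n) (b m)) \<le> ennreal (e n) + ennreal (e m)"
      unfolding b_def using two[OF \<phi>(1) \<phi>(1)] add_mono[OF \<phi>(2) \<phi>(2)] by (rule order_trans)
    then show ?thesis using e[of n] e[of m] by (simp flip: ennreal_plus)
  qed
  have "Cauchy b"
  proof (rule metric_CauchyI)
    fix d :: real assume "0 < d"
    with e_lim have "\<forall>\<^sub>F n in sequentially. e n < d / 2"
      by (intro order_tendstoD(2)[where a = "d/2"]) auto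
    then obtain n where n: "\<And>i. i \<ge> n \<Longrightarrow> e i < d / 2" by (auto simp: eventually_sequentially)
    have "dist (b i) (b j) < d" if "i \<ge> n" "j \<ge> n" for i j
      using b_dist[of i j] n[OF that(1)] n[OF that(2)] by simp
    then show "\<exists>M. \<forall>i\<ge>M. \<forall>j\<ge>M. dist (b i) (b j) < d" by blast
  qed
  then obtain l where l: "b \<longlonglongrightarrow> l" using Cauchy_convergent convergent_def by blast
  have "ennreal (dist l (\<beta> (law \<mu> \<psi>))) \<le> displacement \<mu> \<psi>" if \<psi>: "simple_function borel \<psi>" for \<psi>
  proof (rule LIMSEQ_le)
    show "(\<lambda>n. ennreal (dist (b n) (\<beta> (law \<mu> \<psi>)))) \<longlonglongrightarrow> ennreal (dist l (\<beta> (law \<mu> \<psi>)))"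
      by (intro tendsto_ennrealI tendsto_intros l)
    have "(\<lambda>n. ennreal (e n) + displacement \<mu> \<psi>) \<longlonglongrightarrow> ennreal 0 + displacement \<mu> \<psi>"
      by (intro tendsto_add tendsto_ennrealI e_lim tendsto_const)
    then show "(\<lambda>n. ennreal (e n) + displacement \<mu> \<psi>) \<longlonglongrightarrow> displacement \<mu> \<psi>" by simp
    show "\<exists>N. \<forall>n\<ge>N. ennreal (dist (b n) (\<beta> (law \<mu> \<psi>))) \<le> ennreal (e n) + displacement \<mu> \<psi>"
      unfolding b_def using order_trans[OF two[OF \<phi>(1) \<psi>] add_right_mono[OF \<phi>(2)]] by blast
  qed
  then show ?thesis by blast
qed

lemma conical_bicombing_imp_barycenter_map:
  fixes \<sigma> :: "'a::complete_space \<Rightarrow> 'a \<Rightarrow> real \<Rightarrow> 'a"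
  assumes "conical_bicombing \<sigma>"
  shows "\<exists>\<beta> :: 'a measure \<Rightarrow> 'a. contracting_barycenter_map \<beta>"
proof -
  obtain \<beta>\<^sub>0 :: "'a pmf \<Rightarrow> 'a" where \<beta>\<^sub>0_return: "\<And>x. \<beta>\<^sub>0 (return_pmf x) = x"
    and \<beta>\<^sub>0: "\<And>p. finite (set_pmf p) \<Longrightarrow>
      dist (\<beta>\<^sub>0 (map_pmf fst p)) (\<beta>\<^sub>0 (map_pmf snd p)) \<le> expectation p (\<lambda>z. dist (fst z) (snd z))"
    using finite_barycenter_map[OF assms] by metis
  define bary where "bary \<mu> b \<longleftrightarrow> (\<forall>\<phi>. simple_function borel \<phi> \<longrightarrow>
    ennreal (dist b (\<beta>\<^sub>0 (law \<mu> \<phi>))) \<le> displacement \<mu> \<phi>)" for \<mu> b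
  define \<beta> where "\<beta> \<mu> = (SOME b. bary \<mu> b)" for \<mu>
  have \<beta>: "bary \<mu> (\<beta> \<mu>)" if "prob_space \<mu>" "sets \<mu> = sets borel"
    "\<And>e. 0 < e \<Longrightarrow> \<exists>\<phi>. simple_function borel \<phi> \<and> displacement \<mu> \<phi> \<le> ennreal e" for \<mu>
    unfolding \<beta>_def bary_def by (rule someI_ex, rule ex_barycenter[OF \<beta>\<^sub>0 that])
  have \<beta>_P1: "bary \<mu> (\<beta> \<mu>)" if "\<mu> \<in> P1" for \<mu>
    using that by (intro \<beta> P1_ex_simple_function) (simp_all add: P1_def radon_prob_def)
  have lipschitz: "ennreal (dist (\<beta> \<mu>) (\<beta> \<nu>)) \<le> W1 \<mu> \<nu>" if "\<mu> \<in> P1" "\<nu> \<in> P1" for \<mu> \<nu>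
    unfolding W1_def
  proof (rule INF_greatest, rule ennreal_le_epsilon)
    fix \<gamma> and e :: real assume \<gamma>: "\<gamma> \<in> couplings \<mu> \<nu>" and "0 < e"
    have sets: "sets \<gamma> = sets borel" and "prob_space \<gamma>"
      and marg: "distr \<gamma> borel fst = \<mu>" "distr \<gamma> borel snd = \<nu>"
      using \<gamma> by (auto simp: couplings_def)
    \<comment> \<open>Couplings live on the Borel sets of the product space, so continuity suffices,
      also for the distance.\<close>
    have meas: "f \<in> measurable \<gamma> borel" if "continuous_on UNIV f" for f :: "'a \<times> 'a \<Rightarrow> 'c::topological_space"
      using borel_measurable_continuous_onI[OF that] measurable_cong_sets[OF sets refl] by blast
    \<comment> \<open>There are four errors: each measure contributes one displacement and one
      distance between its barycenter and that of its approximation.\<close>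
    define d where "d = e / 4"
    have "0 < d" using \<open>0 < e\<close> by (simp add: d_def)
    obtain \<phi> where \<phi>: "simple_function borel \<phi>" "displacement \<mu> \<phi> \<le> ennreal d"
      using P1_ex_simple_function[OF \<open>\<mu> \<in> P1\<close> \<open>0 < d\<close>] by blast
    obtain \<psi> where \<psi>: "simple_function borel \<psi>" "displacement \<nu> \<psi> \<le> ennreal d"
      using P1_ex_simple_function[OF \<open>\<nu> \<in> P1\<close> \<open>0 < d\<close>] by blast
    let ?b = "\<beta>\<^sub>0 (law \<mu> \<phi>)" and ?c = "\<beta>\<^sub>0 (law \<nu> \<psi>)"
    let ?I = "\<integral>\<^sup>+ z. ennreal (dist (fst z) (snd z)) \<partial>\<gamma>"
    have "fst \<in> measurable \<gamma> borel" "snd \<in> measurable \<gamma> borel"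
      "(\<lambda>z. dist (fst z) (snd z)) \<in> borel_measurable \<gamma>"
      by (intro meas continuous_intros)+
    from dist_barycenters_le[OF \<beta>\<^sub>0 \<open>prob_space \<gamma>\<close> this \<phi>(1) \<psi>(1)]
    have "ennreal (dist ?b ?c) \<le> displacement \<mu> \<phi> + ?I + displacement \<nu> \<psi>"
      unfolding marg .
    also have "\<dots> \<le> ennreal d + ?I + ennreal d"
      by (intro add_mono \<phi> \<psi> order_refl)
    finally have bc: "ennreal (dist ?b ?c) \<le> ennreal d + ?I + ennreal d" .
    have b: "ennreal (dist (\<beta> \<mu>) ?b) \<le> ennreal d" and c: "ennreal (dist (\<beta> \<nu>) ?c) \<le> ennreal d"
      using \<beta>_P1[OF \<open>\<mu> \<in> P1\<close>] \<beta>_P1[OF \<open>\<nu> \<in> P1\<close>] \<phi> \<psi> order_trans unfolding bary_def by blast+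
    have "dist (\<beta> \<mu>) (\<beta> \<nu>) \<le> dist (\<beta> \<mu>) ?b + dist ?b ?c + dist (\<beta> \<nu>) ?c"
      using dist_triangle[of "\<beta> \<mu>" "\<beta> \<nu>" ?b] dist_triangle2[of ?b "\<beta> \<nu>" ?c] by linarith
    then have "ennreal (dist (\<beta> \<mu>) (\<beta> \<nu>)) \<le> ennreal (dist (\<beta> \<mu>) ?b) + ennreal (dist ?b ?c) + ennreal (dist (\<beta> \<nu>) ?c)"
      by (simp add: ennreal_leI flip: ennreal_plus)
    also have "\<dots> \<le> ennreal d + (ennreal d + ?I + ennreal d) + ennreal d"
      by (intro add_mono b c bc)
    also have "\<dots> = ?I + (ennreal d + ennreal d + ennreal d + ennreal d)"
      by (simp add: ac_simps)
    also have "ennreal d + ennreal d + ennreal d + ennreal d = ennreal e"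
      using \<open>0 < d\<close> by (simp add: d_def flip: ennreal_plus)
    finally show "ennreal (dist (\<beta> \<mu>) (\<beta> \<nu>)) \<le> ?I + ennreal e" .
  qed
  have "\<beta> (return borel x) = x" for x
  proof -
    interpret prob_space "return borel x" by (rule prob_space_return) simp
    \<comment> \<open>The constant function does not move the Dirac measure at \<open>x\<close>, so
      \<open>bary\<close> forces its barycenter to be
      \<open>\<beta>\<^sub>0 (return_pmf x)\<close>.\<close>
    have zero: "displacement (return borel x) (\<lambda>_. x) = 0"
      unfolding displacement_def
      by (subst nn_integral_return) (auto intro: borel_measurable_dist_const)
    then have "bary (return borel x) (\<beta> (return borel x))"
      by (intro \<beta> exI[of _ "\<lambda>_. x"]) (auto simp: prob_space_axioms)
    then have "ennreal (dist (\<beta> (return borel x)) (\<beta>\<^sub>0 (law (return borel x) (\<lambda>_. x)))) \<le> 0"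
      unfolding bary_def using zero by (metis simple_function_const)
    then show ?thesis by (simp add: law_const[OF prob_space_axioms] \<beta>\<^sub>0_return)
  qed
  with lipschitz show ?thesis unfolding contracting_barycenter_map_def by blast
qed

section \<open>From barycenter maps to bicombings\<close>

text \<open>The mass sits on a finite set: its intersection with \<open>S\<close> is compact and
  carries all the mass of \<open>S\<close>, and distances from a fixed point are bounded on
  it.\<close>

lemma distr_simple_in_P1:
  fixes f :: "'b \<Rightarrow> 'a::metric_space"
  assumes M: "prob_space M" and f: "simple_function M f"
  shows "distr M borel f \<in> P1"
proof -
  interpret prob_space M by fact
  have f_meas: "f \<in> measurable M borel" using f by (rule borel_measurable_simple_function)
  have fin: "finite (f ` space M)" using f by (rule simple_functionD)
  have radon: "emeasure (distr M borel f) S =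
      (SUP K\<in>{K. compact K \<and> K \<subseteq> S}. emeasure (distr M borel f) K)" if S: "S \<in> sets borel" for S
  proof (rule antisym)
    let ?K = "S \<inter> f ` space M"
    have K: "compact ?K" using fin by (auto intro: finite_imp_compact)
    have "emeasure (distr M borel f) S = emeasure (distr M borel f) ?K"
      using f_meas S borel_compact[OF K] by (subst (1 2) emeasure_distr) (auto intro!: arg_cong[of _ _ "emeasure M"])
    also have "\<dots> \<le> (SUP K\<in>{K. compact K \<and> K \<subseteq> S}. emeasure (distr M borel f) K)"
      using K by (intro SUP_upper) auto
    finally show "emeasure (distr M borel f) S \<le> \<dots>" .
    show "(SUP K\<in>{K. compact K \<and> K \<subseteq> S}. emeasure (distr M borel f) K) \<le> emeasure (distr M borel f) S"
      using S by (intro SUP_least emeasure_mono) auto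
  qed
  define x\<^sub>0 :: 'a where "x\<^sub>0 = undefined"
  define C where "C = (\<Sum>y\<in>f ` space M. dist y x\<^sub>0)"
  have "(\<integral>\<^sup>+ x. ennreal (dist x x\<^sub>0) \<partial>distr M borel f) = (\<integral>\<^sup>+ x. ennreal (dist (f x) x\<^sub>0) \<partial>M)"
    using f_meas by (subst nn_integral_distr)
      (auto intro!: measurable_compose[OF _ measurable_ennreal] borel_measurable_continuous_onI continuous_intros)
  also have "\<dots> \<le> (\<integral>\<^sup>+ x. ennreal C \<partial>M)"
    using fin unfolding C_def
    by (intro nn_integral_mono ennreal_leI member_le_sum[of _ "f ` space M" "\<lambda>y. dist y x\<^sub>0"]) auto
  also have "\<dots> < \<infinity>" by (simp add: emeasure_space_1)
  finally show ?thesis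
    using radon prob_space_distr[OF f_meas] unfolding P1_def radon_prob_def by auto
qed

text \<open>The joint law of \<open>f\<close> and \<open>g\<close> is a coupling. Pairs of simple
  functions are simple, hence measurable into the Borel sets of the product even without second
  countability.\<close>

lemma barycenter_map_distr_simple:
  fixes f g :: "'b \<Rightarrow> 'a::metric_space"
  assumes \<beta>: "contracting_barycenter_map \<beta>"
    and M: "prob_space M" and f: "simple_function M f" and g: "simple_function M g"
  shows "ennreal (dist (\<beta> (distr M borel f)) (\<beta> (distr M borel g))) \<le>
    (\<integral>\<^sup>+x. ennreal (dist (f x) (g x)) \<partial>M)"
proof -
  let ?h = "\<lambda>x. (f x, g x)"
  let ?\<gamma> = "distr M borel ?h"
  have h: "?h \<in> measurable M borel"
    using simple_function_Pair[OF f g] by (rule borel_measurable_simple_function)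
  have "(fst :: 'a \<times> 'a \<Rightarrow> 'a) \<in> borel \<rightarrow>\<^sub>M borel" "(snd :: 'a \<times> 'a \<Rightarrow> 'a) \<in> borel \<rightarrow>\<^sub>M borel"
    by (intro borel_measurable_continuous_onI continuous_intros)+
  then have "?\<gamma> \<in> couplings (distr M borel f) (distr M borel g)"
    unfolding couplings_def using h prob_space.prob_space_distr[OF M h]
    by (simp add: distr_distr comp_def)
  then have "W1 (distr M borel f) (distr M borel g) \<le> (\<integral>\<^sup>+ z. ennreal (dist (fst z) (snd z)) \<partial>?\<gamma>)"
    unfolding W1_def by (rule INF_lower)
  also have "\<dots> = (\<integral>\<^sup>+x. ennreal (dist (f x) (g x)) \<partial>M)"
    using h by (subst nn_integral_distr)
      (auto intro!: measurable_compose[OF _ measurable_ennreal] borel_measurable_continuous_onI continuous_intros)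
  finally show ?thesis
    using \<beta> distr_simple_in_P1[OF M f] distr_simple_in_P1[OF M g]
    unfolding contracting_barycenter_map_def by (meson order_trans)
qed

text \<open>The measures (1 - t) \<delta>_x + t \<delta>_y are realised as laws of step functions of
  one uniform variable \<open>u\<close>, so sharing \<open>u\<close> provides every coupling. For
  conicality both step functions jump at \<open>t\<close>; for the geodesic property they differ
  only between \<open>s\<close> and \<open>t\<close>.\<close>

lemma barycenter_map_imp_conical_bicombing:
  fixes \<beta> :: "'a::metric_space measure \<Rightarrow> 'a"
  assumes \<beta>: "contracting_barycenter_map \<beta>"
  shows "\<exists>\<sigma> :: 'a \<Rightarrow> 'a \<Rightarrow> real \<Rightarrow> 'a. conical_bicombing \<sigma>"
proof -
  define U where "U = uniform_measure lborel {0..<1::real}"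
  have U: "prob_space U" unfolding U_def by (rule prob_space_uniform_measure) auto
  have U_integral: "(\<integral>\<^sup>+u. h u \<partial>U) = (\<integral>\<^sup>+u. h u * indicator {0..<1} u \<partial>lborel)"
    if "h \<in> borel_measurable borel" for h
    unfolding U_def using that by (subst nn_integral_uniform_measure) (auto simp: divide_ennreal_def)
  define step where "step x y t u = (if u < t then y else x)" for x y :: 'a and t u :: real
  have simple: "simple_function U (step x y t)" for x y t
    unfolding step_def lessThan_iff[symmetric] by (intro simple_function_If_set) (auto simp: U_def)
  define \<sigma> where "\<sigma> x y t = \<beta> (distr U borel (step x y t))" for x y t
  have le: "ennreal (dist (\<sigma> x y s) (\<sigma> x' y' t)) \<le> (\<integral>\<^sup>+u. ennreal (dist (step x y s u) (step x' y' t u)) \<partial>U)"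
    for x y x' y' s t
    unfolding \<sigma>_def by (rule barycenter_map_distr_simple[OF \<beta> U simple simple])
  have conical: "dist (\<sigma> x y t) (\<sigma> x' y' t) \<le> (1 - t) * dist x x' + t * dist y y'"
    if t: "t \<in> {0..1}" for x y x' y' t
  proof -
    have "(\<integral>\<^sup>+u. ennreal (dist (step x y t u) (step x' y' t u)) \<partial>U) =
        (\<integral>\<^sup>+u. (ennreal (dist y y') * indicator {0..<t} u + ennreal (dist x x') * indicator {t..<1} u) \<partial>lborel)"
    proof (subst U_integral)
      have "(\<lambda>u. ennreal (dist (step x y t u) (step x' y' t u))) =
          (\<lambda>u. if u < t then ennreal (dist y y') else ennreal (dist x x'))"
        by (auto simp: step_def)
      then show "(\<lambda>u. ennreal (dist (step x y t u) (step x' y' t u))) \<in> borel_measurable borel" by simp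
    qed (use t in \<open>auto intro!: nn_integral_cong simp: step_def indicator_def\<close>)
    also have "\<dots> = ennreal (dist y y') * ennreal t + ennreal (dist x x') * ennreal (1 - t)"
      using t by (subst nn_integral_add) (auto simp: nn_integral_cmult_indicator)
    also have "\<dots> = ennreal ((1 - t) * dist x x' + t * dist y y')"
      using t by (simp add: mult.commute add.commute ennreal_mult flip: ennreal_plus ennreal_mult)
    finally have "ennreal (dist (\<sigma> x y t) (\<sigma> x' y' t)) \<le> ennreal ((1 - t) * dist x x' + t * dist y y')"
      using le[of x y t x' y' t] by (simp only:)
    then show ?thesis using t by (subst (asm) ennreal_le_iff) auto
  qed
  have short: "dist (\<sigma> x y s) (\<sigma> x y t) \<le> (t - s) * dist x y"
    if st: "0 \<le> s" "s \<le> t" "t \<le> 1" for x y s t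
  proof -
    have "(\<integral>\<^sup>+u. ennreal (dist (step x y s u) (step x y t u)) \<partial>U) =
        (\<integral>\<^sup>+u. ennreal (dist x y) * indicator {s..<t} u \<partial>lborel)"
    proof (subst U_integral)
      have "(\<lambda>u. ennreal (dist (step x y s u) (step x y t u))) =
          (\<lambda>u. if s \<le> u \<and> u < t then ennreal (dist x y) else 0)"
        using st by (auto simp: step_def)
      then show "(\<lambda>u. ennreal (dist (step x y s u) (step x y t u))) \<in> borel_measurable borel" by simp
    qed (use st in \<open>auto intro!: nn_integral_cong simp: step_def indicator_def\<close>)
    also have "\<dots> = ennreal (dist x y) * ennreal (t - s)"
      using st by (simp add: nn_integral_cmult_indicator)
    also have "\<dots> = ennreal ((t - s) * dist x y)"
      using st by (simp add: mult.commute flip: ennreal_mult)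
    finally have "ennreal (dist (\<sigma> x y s) (\<sigma> x y t)) \<le> ennreal ((t - s) * dist x y)"
      using le[of x y s x y t] by (simp only:)
    then show ?thesis using st by (subst (asm) ennreal_le_iff) auto
  qed
  have const: "\<sigma> x x t = x" for x t
  proof -
    interpret prob_space U by (rule U)
    have "distr U borel (\<lambda>_. x) = return borel x" by (simp add: distr_const)
    moreover have "step x x t = (\<lambda>_. x)" by (auto simp: step_def)
    ultimately show ?thesis using \<beta> by (simp add: \<sigma>_def contracting_barycenter_map_def)
  qed
  \<comment> \<open>The conical estimate at the parameters 0 and 1, against the constant paths
    \<open>\<sigma> x x\<close> and \<open>\<sigma> y y\<close>.\<close>
  have start: "\<sigma> x y 0 = x" and finish: "\<sigma> x y 1 = y" for x y
    using conical[of 0 x y x x] conical[of 1 x y y y] const by simp_all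
  have "dist (\<sigma> x y s) (\<sigma> x y t) = \<bar>s - t\<bar> * dist x y" if "s \<in> {0..1}" "t \<in> {0..1}" for x y s t
    using that
  proof (induction s t rule: linorder_wlog)
    case (le s t)
    \<comment> \<open>The upper bounds for the three pieces add up to \<open>dist x y\<close>, so
      the triangle inequality forces equality in each.\<close>
    have "dist x (\<sigma> x y s) \<le> s * dist x y" "dist (\<sigma> x y t) y \<le> (1 - t) * dist x y"
      using short[of 0 s x y] short[of t 1 x y] le by (simp_all add: start finish)
    moreover have "dist x y \<le> dist x (\<sigma> x y s) + dist (\<sigma> x y s) (\<sigma> x y t) + dist (\<sigma> x y t) y"
      using dist_triangle[of x y "\<sigma> x y s"] dist_triangle[of "\<sigma> x y s" y "\<sigma> x y t"] by linarith
    ultimately show ?case using short[of s t x y] le by (simp add: algebra_simps)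
  next
    case (sym s t)
    then show ?case by (simp add: dist_commute abs_minus_commute)
  qed
  then have "conical_bicombing \<sigma>"
    unfolding conical_bicombing_def bicombing_def geodesic_from_to_def
    using start finish conical by blast
  then show ?thesis by blast
qed

theorem theorem1p2:
  shows "(\<exists>\<sigma> :: 'a::complete_space \<Rightarrow> 'a \<Rightarrow> real \<Rightarrow> 'a. conical_bicombing \<sigma>) \<longleftrightarrow>
         (\<exists>\<beta> :: 'a measure \<Rightarrow> 'a. contracting_barycenter_map \<beta>)"
  using conical_bicombing_imp_barycenter_map barycenter_map_imp_conical_bicombing by blast

end
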